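(* Let $N\ge3$, $\alpha=N-2$ and $V\in C(\mathbb{R}^N;[0,\infty))$. Assume that $$\lim_{R\to\infty}\frac{1}{R^{N-2}}\int_{B_{2R}\setminus B_R}V=0.$$ Let $\varepsilon>0$. If $u_\varepsilon\in H^1_{\mathrm{loc}}(\mathbb{R}^N)\cap L^2\bigl(\mathbb{R}^N,(1+|x|)^{-2}\,dx\bigr)$ is a positive weak solution of $$-\varepsilon^2\Delta u_\varepsilon+Vu_\varepsilon=\varepsilon^{-(N-2)}\bigl(I_{N-2}*|u_\varepsilon|^2\bigr)u_\varepsilon\quad\text{in }\mathbb{R}^N,$$ then $$\frac{1}{\varepsilon^N}\int_{\mathbb{R}^N}|u_\varepsilon|^2\le\Gamma\bigl(\tfrac{N-2}{2}\bigr)\,\pi^{N/2}\,2^{N-2}\Bigl(\frac{N-2}{2}\Bigr)^2.$$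
   Context: $B_R$ is the ball of radius $R$ centred at the origin. $I_{N-2}(x)=\dfrac{1}{\Gamma(\frac{N-2}{2})\pi^{N/2}2^{N-2}|x|^{2}}$ for $x\in\mathbb{R}^N\setminus\{0\}$ (the Riesz potential of order $N-2$). Weak solution means that the right-hand side of the equation is locally integrable and $\int_{\mathbb{R}^N}\varepsilon^2\nabla u\cdot\nabla\varphi+Vu\varphi=\varepsilon^{-(N-2)}\int_{\mathbb{R}^N}(I_{N-2}*|u|^2)u\varphi$ for all $\varphi\in C^\infty_c(\mathbb{R}^N)$. *)

theory Defs
  imports "HOL-Analysis.Analysis"
begin

text \<open>
  The space \<open>\<real>\<^sup>N\<close> is \<open>real ^ 'n\<close> with \<open>N = CARD('n)\<close>. Functions are representatives of
  almost-everywhere classes with respect to Lebesgue measure.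
\<close>

primrec Ck :: "nat \<Rightarrow> (real ^ 'n \<Rightarrow> real) \<Rightarrow> bool" where
  "Ck 0 f \<longleftrightarrow> continuous_on UNIV f"
| "Ck (Suc k) f \<longleftrightarrow> (\<forall>x. f differentiable (at x)) \<and>
     (\<forall>v. Ck k (\<lambda>x. frechet_derivative f (at x) v))"

definition test_fun :: "(real ^ 'n \<Rightarrow> real) set" where
  "test_fun = {\<phi>. (\<forall>k. Ck k \<phi>) \<and> compact (closure {x. \<phi> x \<noteq> 0})}"

definition grad :: "(real ^ 'n \<Rightarrow> real) \<Rightarrow> real ^ 'n \<Rightarrow> real ^ 'n" where
  "grad \<phi> x = (\<chi> i. frechet_derivative \<phi> (at x) (axis i 1))"

definition L1_loc :: "(real ^ 'n \<Rightarrow> 'b::euclidean_space) set" where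
  "L1_loc = {f. \<forall>K. compact K \<longrightarrow> f absolutely_integrable_on K}"

definition L2_loc :: "(real ^ 'n \<Rightarrow> 'b::euclidean_space) set" where
  "L2_loc = {f. f \<in> borel_measurable lebesgue \<and>
     (\<forall>K. compact K \<longrightarrow> (\<lambda>x. (norm (f x))\<^sup>2) absolutely_integrable_on K)}"

definition has_weak_grad :: "(real ^ 'n \<Rightarrow> real) \<Rightarrow> (real ^ 'n \<Rightarrow> real ^ 'n) \<Rightarrow> bool" where
  "has_weak_grad u G \<longleftrightarrow> u \<in> L1_loc \<and> G \<in> L1_loc \<and>
     (\<forall>\<phi>\<in>test_fun. (LINT x|lebesgue. u x *\<^sub>R grad \<phi> x) = - (LINT x|lebesgue. \<phi> x *\<^sub>R G x))"

text \<open>The weak gradient is unique up to null sets; a representative is chosen.\<close>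

definition weak_grad :: "(real ^ 'n \<Rightarrow> real) \<Rightarrow> real ^ 'n \<Rightarrow> real ^ 'n" where
  "weak_grad u = (SOME G. has_weak_grad u G)"

definition H1_loc :: "(real ^ 'n \<Rightarrow> real) set" where
  "H1_loc = {u. u \<in> L2_loc \<and> (\<exists>G. has_weak_grad u G) \<and> weak_grad u \<in> L2_loc}"

text \<open>\<open>L\<^sup>2(\<real>\<^sup>N, (1 + |x|)\<^sup>-\<^sup>2 dx)\<close>\<close>

definition L2_weighted :: "(real ^ 'n \<Rightarrow> real) set" where
  "L2_weighted = {u. u \<in> borel_measurable lebesgue \<and>
     integrable lebesgue (\<lambda>x. \<bar>u x\<bar>\<^sup>2 / (1 + norm x)\<^sup>2)}"

text \<open>
  The Riesz potential \<open>I\<^sub>\<alpha>\<close> of order \<open>\<alpha> = N - 2\<close>. Its value at the origin is \<open>0\<close> by the convention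
  on division, which does not affect the convolution.
\<close>

definition riesz :: "real ^ 'n \<Rightarrow> real" where
  "riesz x = 1 / (Gamma ((real CARD('n) - 2) / 2) * pi powr (real CARD('n) / 2)
                  * 2 ^ (CARD('n) - 2) * (norm x)\<^sup>2)"

text \<open>Convolution with a nonnegative function, with value \<open>\<infinity>\<close> where the integral diverges.\<close>

definition riesz_conv :: "(real ^ 'n \<Rightarrow> real) \<Rightarrow> real ^ 'n \<Rightarrow> ennreal" where
  "riesz_conv f x = (\<integral>\<^sup>+ y. ennreal (riesz (x - y) * f y) \<partial>lebesgue)"

text \<open>
  The first conjunct is local integrability of the right-hand side. It makes the convolution
  finite almost everywhere on \<open>{x. u x \<noteq> 0}\<close>, so \<^const>\<open>enn2real\<close> in the second conjunct
  loses nothing.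
\<close>

definition weak_solution ::
    "real \<Rightarrow> (real ^ 'n \<Rightarrow> real) \<Rightarrow> (real ^ 'n \<Rightarrow> real) \<Rightarrow> bool" where
  "weak_solution \<epsilon> V u \<longleftrightarrow>
     (\<forall>K. compact K \<longrightarrow>
        (\<integral>\<^sup>+ x\<in>K. riesz_conv (\<lambda>y. \<bar>u y\<bar>\<^sup>2) x * ennreal \<bar>u x\<bar> \<partial>lebesgue) < \<infinity>) \<and>
     (\<forall>\<phi>\<in>test_fun.
        (LINT x|lebesgue. \<epsilon>\<^sup>2 * (weak_grad u x \<bullet> grad \<phi> x) + V x * u x * \<phi> x)
        = (1 / \<epsilon> ^ (CARD('n) - 2)) *
          (LINT x|lebesgue. enn2real (riesz_conv (\<lambda>y. \<bar>u y\<bar>\<^sup>2) x) * u x * \<phi> x))"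

end

theory Submission imports Defs "HOL-Real_Asymp.Real_Asymp" begin

text \<open>
  The existence of a positive solution forces the quadratic form of
  \<open>-\<epsilon>\<^sup>2\<Delta> + V - \<epsilon>\<^sup>-\<^sup>(\<^sup>N\<^sup>-\<^sup>2\<^sup>)(I * |u|\<^sup>2)\<close> to be nonnegative (test with \<open>\<phi>\<^sup>2/u\<close>).
  If \<open>m\<close> is the mass of \<open>u\<^sup>2\<close> in the ball of radius \<open>\<rho>\<close>, the convolution is at least
  \<open>m/(A(|x| + \<rho>)\<^sup>2)\<close>, with \<open>1/(A|x|\<^sup>2)\<close> the Riesz potential. Near-optimal functions for
  Hardy's inequality, moved to infinity where \<open>V\<close> is negligible, then give
  \<open>m/(A\<epsilon>\<^sup>N) \<le> ((N-2)/2)\<^sup>2\<close>, and \<open>\<rho> \<rightarrow> \<infinity>\<close>.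

  To avoid any Sobolev calculus, the equation is mollified: convolving with a smooth kernel turns
  \<open>u\<close> into a smooth positive function \<open>U\<close> which satisfies pointwise, on a given compact set, the
  inequality \<open>-\<Delta>U \<ge> (q - \<eta>)U\<close> with \<open>q\<close> the continuous lower bound of the potential, as soon
  as the kernel has small support. No convergence of mollifications is needed.
\<close>

subsection \<open>Test functions\<close>

text \<open>The bound is a matter of scaling. The tail \<open>m / (A * (norm x)^2)\<close> of the
  convolution is a Hardy potential, and ((N-2)/2)^2 is the largest coefficient that Hardy's
  inequality tolerates, even if it is tested only near infinity. The near-optimizers are
  |x|^(-(N-2)/2) times a cutoff in ln |x|. At distance R their squares have size R^(-(N-2)), so the
  potential costs R^(-(N-2)) times integrals of V over shells, which is what the hypothesis sends to
  0. A cutoff of logarithmic width T costs 3/T^2.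

  Two obstacles shape the rest: \<phi>^2/u is not a smooth test function, and the convolution need
  not be continuous. Once the convolution is replaced by a continuous minorant, the inequality is
  linear in u, and averaging it with a nonnegative kernel loses only the oscillation of the minorant
  and of V over the support of the kernel.

  The limits are \<eta> to 0, R to infinity, T to infinity, \<rho> to infinity, in this order: the
  \<eta> term grows like R^2, so it has to disappear at fixed R.\<close>

lemma Ck_SucD: "Ck (Suc k) f \<Longrightarrow> Ck k f"
proof (induction k arbitrary: f)
  case 0
  then show ?case
    by (auto intro!: continuous_at_imp_continuous_on differentiable_imp_continuous_within)
next
  case (Suc k)
  then show ?case by (metis Ck.simps(2))
qed

lemma Ck_SucI:
  assumes "\<And>x. (f has_derivative f' x) (at x)" and "\<And>v. Ck k (\<lambda>x. f' x v)"
  shows "Ck (Suc k) f"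
proof -
  have "frechet_derivative f (at x) = f' x" for x
    using frechet_derivative_at[OF assms(1)] by simp
  with assms show ?thesis by (auto simp: differentiable_def)
qed

lemma Ck_SucE:
  assumes "Ck (Suc k) f"
  shows "(f has_derivative frechet_derivative f (at x)) (at x)"
    and "Ck k (\<lambda>x. frechet_derivative f (at x) v)"
  using assms by (auto simp: frechet_derivative_works)

lemma Ck_const: "Ck k (\<lambda>x. c)"
  by (induction k arbitrary: c) (auto simp: frechet_derivative_const)

lemma Ck_add: "Ck k f \<Longrightarrow> Ck k g \<Longrightarrow> Ck k (\<lambda>x. f x + g x)"
proof (induction k arbitrary: f g)
  case 0 then show ?case by (auto intro!: continuous_intros)
next
  case (Suc k)
  show ?case
    by (rule Ck_SucI[OF has_derivative_add[OF Ck_SucE(1)[OF Suc.prems(1)] Ck_SucE(1)[OF Suc.prems(2)]]])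
      (intro Suc.IH Ck_SucE(2)[OF Suc.prems(1)] Ck_SucE(2)[OF Suc.prems(2)])
qed

lemma Ck_mult: "Ck k f \<Longrightarrow> Ck k g \<Longrightarrow> Ck k (\<lambda>x. f x * g x)"
proof (induction k arbitrary: f g)
  case 0 then show ?case by (auto intro!: continuous_intros)
next
  case (Suc k)
  show ?case
    by (rule Ck_SucI[OF has_derivative_mult[OF Ck_SucE(1)[OF Suc.prems(1)] Ck_SucE(1)[OF Suc.prems(2)]]])
      (intro Ck_add Suc.IH Ck_SucE(2)[OF Suc.prems(1)] Ck_SucE(2)[OF Suc.prems(2)]
        Ck_SucD[OF Suc.prems(1)] Ck_SucD[OF Suc.prems(2)])
qed

lemma Ck_inner: "Ck k (\<lambda>x::real^'n. x \<bullet> v)"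
proof (cases k)
  case (Suc j)
  have "((\<lambda>x. x \<bullet> v) has_derivative (\<lambda>w. w \<bullet> v)) (at x)" for x :: "real^'n"
    by (auto intro!: derivative_eq_intros)
  then show ?thesis unfolding Suc by (rule Ck_SucI) (rule Ck_const)
qed (auto intro!: continuous_intros)

lemma Ck_reflect: "Ck k f \<Longrightarrow> Ck k (\<lambda>y. f (x - y))"
proof (induction k arbitrary: f)
  case 0
  then show ?case by (auto intro!: continuous_on_compose2[of UNIV f] continuous_intros)
next
  case (Suc k)
  have D: "((\<lambda>y. f (x - y)) has_derivative (\<lambda>v. frechet_derivative f (at (x - y)) (- v))) (at y)" for y
    by (rule has_derivative_compose[of "\<lambda>y. x - y" "\<lambda>v. - v" y UNIV f])
      (auto intro!: derivative_eq_intros Ck_SucE(1)[OF Suc.prems])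
  \<comment> \<open>The minus sign of the chain rule sits in the direction, so the induction
    hypothesis is applied to the derivative of \<open>f\<close> in direction
    \<open>- v\<close>.\<close>
  show ?case
    by (rule Ck_SucI[OF D]) (rule Suc.IH[OF Ck_SucE(2)[OF Suc.prems]])
qed

lemma test_funD:
  assumes "k \<in> test_fun"
  shows "(k has_derivative frechet_derivative k (at x)) (at x)" "continuous_on UNIV k"
    "\<exists>b>0. \<forall>x. b \<le> norm x \<longrightarrow> k x = 0"
proof -
  have C: "Ck j k" for j using assms by (auto simp: test_fun_def)
  show "(k has_derivative frechet_derivative k (at x)) (at x)" by (rule Ck_SucE(1)[OF C])
  show "continuous_on UNIV k" using C[of 0] by simp
  have "bounded (closure {x. k x \<noteq> 0})" using assms compact_imp_bounded by (auto simp: test_fun_def)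
  then obtain b where "b > 0" "\<forall>x\<in>closure {x. k x \<noteq> 0}. norm x \<le> b" 
    by (auto simp: bounded_pos)
  \<comment> \<open>The bound \<open>b\<close> may be attained on the closure of the support;
    \<open>b + 1\<close> is safely outside.\<close>
  then show "\<exists>b>0. \<forall>x. b \<le> norm x \<longrightarrow> k x = 0"
    using closure_subset[of "{x. k x \<noteq> 0}"] by (intro exI[of _ "b+1"]) force
qed

lemma test_funI:
  assumes "\<And>j. Ck j k" "\<And>x. b \<le> norm x \<Longrightarrow> k x = 0"
  shows "k \<in> test_fun"
proof -
  have "{x. k x \<noteq> 0} \<subseteq> cball 0 b" using assms(2) by (auto simp: not_le[symmetric]) (metis nle_le)
  then have "bounded (closure {x. k x \<noteq> 0})"
    by (meson bounded_cball bounded_closure bounded_subset)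
  with assms(1) show ?thesis by (auto simp: test_fun_def compact_eq_bounded_closed)
qed

lemma test_fun_deriv:
  assumes "k \<in> test_fun"
  shows "(\<lambda>x. frechet_derivative k (at x) v) \<in> test_fun"
proof -
  obtain b where b: "b > 0" "\<And>x. b \<le> norm x \<Longrightarrow> k x = 0"
    using test_funD(3)[OF assms] by blast
  \<comment> \<open>A point of norm \<open>b\<close> need not have a neighbourhood on which
    \<open>k\<close> vanishes. From radius \<open>b + 1\<close> on, the open set
    \<open>{x. b < norm x}\<close> is one.\<close>
  have "frechet_derivative k (at x) v = 0" if "b + 1 \<le> norm x" for x
  proof -
    have "open {x. b < norm x}" by (intro open_Collect_less continuous_intros)
    then have "\<forall>\<^sub>F y in nhds x. y \<in> {x. b < norm x}" 
      using that by (intro eventually_nhds_in_open) auto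
    then have "\<forall>\<^sub>F y in nhds x. k y = 0" by eventually_elim (use b in auto)
    then have "(k has_derivative (\<lambda>_. 0)) (at x)"
      by (intro has_derivative_transform_eventually[OF has_derivative_const[of 0]])
        (auto simp: eventually_at_filter elim: eventually_mono dest: eventually_nhds_x_imp_x)
    then show ?thesis using frechet_derivative_at by metis
  qed
  then show ?thesis using assms
    by (intro test_funI[where b="b+1"]) (auto simp: test_fun_def intro: Ck_SucE(2))
qed

lemma test_fun_reflect:
  assumes "k \<in> test_fun"
  shows "(\<lambda>y. k (x - y)) \<in> test_fun"
proof -
  obtain b where b: "b > 0" "\<And>x. b \<le> norm x \<Longrightarrow> k x = 0"
    using test_funD(3)[OF assms] by blast
  have "k (x - y) = 0" if "b + norm x \<le> norm y" for y
    using b(2)[of "x - y"] norm_triangle_ineq2[of y x] that by (auto simp: norm_minus_commute)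
  then show ?thesis using assms
    by (intro test_funI[where b="b + norm x"] Ck_reflect) (auto simp: test_fun_def)
qed

lemma grad_reflect:
  assumes "k \<in> test_fun"
  shows "grad (\<lambda>y. k (x - y)) y = (\<chi> i. - frechet_derivative k (at (x - y)) (axis i 1))"
proof -
  have D: "((\<lambda>y. k (x - y)) has_derivative (\<lambda>v. frechet_derivative k (at (x - y)) (- v))) (at y)"
    by (rule has_derivative_compose[of "\<lambda>y. x - y" "\<lambda>v. - v" y UNIV k])
      (auto intro!: derivative_eq_intros test_funD(1)[OF assms])
  have "linear (frechet_derivative k (at (x - y)))"
    using test_funD(1)[OF assms] has_derivative_linear by blast
  then show ?thesis
    unfolding grad_def frechet_derivative_at[OF D, symmetric] by (simp add: linear_neg)
qed

text \<open>This family is closed under differentiation up to linear combinations, which makes smoothness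
  of the bump function an induction over all \<open>n\<close> at once.\<close>

definition flat :: "nat \<Rightarrow> real \<Rightarrow> real" where
  "flat n t = (if t \<le> 0 then 0 else exp (- 1 / t) / t ^ n)"

text \<open>For positive \<open>t\<close> this is the quotient rule. It persists at 0 because
  exp(-1/t) beats every power of t, so the right difference quotient tends to 0, as the left one
  does trivially.\<close>

lemma DERIV_flat: "(flat n has_real_derivative flat (n + 2) t - real n * flat (n + 1) t) (at t)"
proof -
  consider "t < 0" | "t = 0" | "t > 0" by linarith
  then show ?thesis
  proof cases
    case 1
    then have "\<forall>\<^sub>F x in nhds t. x < 0" by (intro order_tendstoD[of "\<lambda>x. x"]) (auto simp: filterlim_ident)
    then have ev: "\<forall>\<^sub>F x in nhds t. flat n x = 0" by eventually_elim (auto simp: flat_def)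
    have "(flat n has_real_derivative 0) (at t)"
      using DERIV_cong_ev[OF refl ev refl] by simp
    then show ?thesis using 1 by (simp add: flat_def)
  next
    case 2
    have "((\<lambda>h. flat n h / h) \<longlongrightarrow> 0) (at_right 0)"
    proof (rule Lim_transform_eventually)
      show "((\<lambda>h::real. exp (- 1 / h) / h ^ n / h) \<longlongrightarrow> 0) (at_right 0)" by real_asymp
      show "\<forall>\<^sub>F h in at_right 0. exp (- 1 / h) / h ^ n / h = flat n h / h"
        by (auto simp: flat_def eventually_at_filter)
    qed
    moreover have "((\<lambda>h. flat n h / h) \<longlongrightarrow> 0) (at_left 0)"
      by (rule tendsto_eventually) (auto simp: flat_def eventually_at_filter)
    ultimately have "((\<lambda>h. flat n h / h) \<longlongrightarrow> 0) (at 0)"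
      by (simp add: filterlim_at_split)
    then show ?thesis using 2 by (simp add: DERIV_def) (simp add: flat_def)
  next
    case 3
    then have "\<forall>\<^sub>F x in nhds t. x > 0" by (intro order_tendstoD[of "\<lambda>x. x"]) (auto simp: filterlim_ident)
    then have ev: "\<forall>\<^sub>F x in nhds t. flat n x = exp (- 1 / x) / x ^ n" by eventually_elim (auto simp: flat_def)
    have "((\<lambda>x. exp (- 1 / x) / x ^ n) has_real_derivative flat (n + 2) t - real n * flat (n + 1) t) (at t)"
    proof (rule DERIV_cong)
      show "((\<lambda>x. exp (- 1 / x) / x ^ n) has_real_derivative
          (exp (- 1 / t) * (1 / t\<^sup>2) * t ^ n - exp (- 1 / t) * (real n * t ^ (n - 1))) / (t ^ n * t ^ n)) (at t)"
        using 3 by (auto intro!: derivative_eq_intros simp: power2_eq_square)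
      have n: "real n * t ^ (n - 1) = real n * t ^ n / t" using 3 by (cases n) auto
      show "(exp (- 1 / t) * (1 / t\<^sup>2) * t ^ n - exp (- 1 / t) * (real n * t ^ (n - 1))) / (t ^ n * t ^ n)
          = flat (n + 2) t - real n * flat (n + 1) t"
        unfolding n using 3 by (simp add: flat_def field_simps power2_eq_square)
    qed
    then show ?thesis
      using DERIV_cong_ev[OF refl ev refl] by simp
  qed
qed

text \<open>The squared norm is a polynomial, so composing with it creates no singularity at the
  origin.\<close>

lemma Ck_flat_ball: "Ck k (\<lambda>z::real^'n. flat n (r\<^sup>2 - (norm z)\<^sup>2))"
proof (induction k arbitrary: n)
  case 0
  have "continuous_on UNIV (flat n)"
    using DERIV_flat by (auto intro!: continuous_at_imp_continuous_on DERIV_isCont)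
  then show ?case by (auto intro!: continuous_on_compose2[of UNIV "flat n"] continuous_intros)
next
  case (Suc k)
  have D: "((\<lambda>z. flat n (r\<^sup>2 - (norm z)\<^sup>2)) has_derivative
     (\<lambda>v. (flat (n + 2) (r\<^sup>2 - (norm z)\<^sup>2) + (- real n) * flat (n + 1) (r\<^sup>2 - (norm z)\<^sup>2)) * (- 2 * (z \<bullet> v)))) (at z)"
    for z :: "real^'n"
  proof -
    have "((\<lambda>z. r\<^sup>2 - (norm z)\<^sup>2) has_derivative (\<lambda>v. - 2 * (z \<bullet> v))) (at z)"
      unfolding power2_norm_eq_inner by (auto intro!: derivative_eq_intros simp: inner_commute)
    from has_derivative_compose[OF this DERIV_flat[unfolded has_field_derivative_def]]
    show ?thesis by simp
  qed
  show ?case by (rule Ck_SucI[OF D]) (intro Ck_add Ck_mult Ck_const Ck_inner Suc.IH)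
qed

text \<open>The kernel is not normalised: the mollified inequality is homogeneous in it, so what
  counts is smoothness, sign and the exact set of positivity.\<close>

lemma bump_exists:
  assumes "r > 0"
  obtains \<zeta> :: "real^'n \<Rightarrow> real" where "\<zeta> \<in> test_fun" "\<And>z. \<zeta> z \<ge> 0" "\<And>z. \<zeta> z > 0 \<longleftrightarrow> norm z < r"
proof
  let ?f = "\<lambda>z::real^'n. flat 0 (r\<^sup>2 - (norm z)\<^sup>2)"
  show "?f z \<ge> 0" for z by (simp add: flat_def)
  show iff: "?f z > 0 \<longleftrightarrow> norm z < r" for z
    using assms by (simp add: flat_def)
  have "?f z = 0" if "r \<le> norm z" for z using iff[of z] that by (simp add: flat_def split: if_splits)
  then show "?f \<in> test_fun" by (intro test_funI[where b=r] Ck_flat_ball)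
qed

subsection \<open>Directional derivatives, integrals and convolutions\<close>

lemma has_derivative_imp_dir:
  assumes "(f has_derivative F) (at x)"
  shows "((\<lambda>t. f (x + t *\<^sub>R e)) has_real_derivative F e) (at 0)"
proof -
  have "((\<lambda>t. f (x + t *\<^sub>R e)) has_derivative (\<lambda>t. F (t *\<^sub>R e))) (at 0)"
    by (rule has_derivative_compose[of "\<lambda>t. x + t *\<^sub>R e" "\<lambda>t. t *\<^sub>R e" 0 UNIV f])
      (use assms in \<open>auto intro!: derivative_eq_intros\<close>)
  moreover have "(\<lambda>t. F (t *\<^sub>R e)) = (*) (F e)"
    using has_derivative_linear[OF assms] by (auto simp: linear_scale mult.commute)
  ultimately show ?thesis by (simp add: has_field_derivative_def)
qed

text \<open>Derivatives at parameter 0 from all base points give the derivative at every parameter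
  along the line, so the mean value inequality applies. The bound serves as the dominating constant
  for difference quotients.\<close>

lemma dir_deriv_lipschitz:
  fixes f :: "'a::real_normed_vector \<Rightarrow> real"
  assumes D: "\<And>x. ((\<lambda>t. f (x + t *\<^sub>R e)) has_real_derivative f' x) (at 0)"
    and M: "\<And>x. \<bar>f' x\<bar> \<le> M"
  shows "\<bar>f (x + t *\<^sub>R e) - f x\<bar> \<le> M * \<bar>t\<bar>"
proof -
  have "((\<lambda>t. f (x + t *\<^sub>R e)) has_real_derivative f' (x + s *\<^sub>R e)) (at s)" for s
  proof -
    have "((\<lambda>t. f (x + (t + s) *\<^sub>R e)) has_real_derivative f' (x + s *\<^sub>R e)) (at 0)"
      using D[of "x + s *\<^sub>R e"] by (simp add: algebra_simps)
    then show ?thesis using DERIV_shift[of "\<lambda>t. f (x + t *\<^sub>R e)" _ 0 s] by simp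
  qed
  from field_differentiable_bound[of UNIV "\<lambda>t. f (x + t *\<^sub>R e)" "\<lambda>s. f' (x + s *\<^sub>R e)" M t 0] this M
  show ?thesis by simp
qed

lemma dir_deriv_seq:
  fixes f :: "'a::real_normed_vector \<Rightarrow> real"
  assumes "((\<lambda>t. f (x + t *\<^sub>R e)) has_real_derivative D) (at 0)"
    and "h \<longlonglongrightarrow> 0" "\<And>n. h n \<noteq> 0"
  shows "(\<lambda>n. (f (x + h n *\<^sub>R e) - f x) / h n) \<longlonglongrightarrow> D"
proof -
  have "((\<lambda>t. (f (x + t *\<^sub>R e) - f x) / t) \<longlongrightarrow> D) (at 0)"
    using assms(1) by (simp add: DERIV_def)
  then show ?thesis using assms(2,3)
    by (auto simp: tendsto_at_iff_sequentially o_def)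
qed

section \<open>Translation invariance and integration by parts\<close>

lemma lborel_integral_translate:
  fixes f :: "'a::euclidean_space \<Rightarrow> real"
  assumes "integrable lborel f"
  shows "integrable lborel (\<lambda>x. f (x + c))" "(LINT x|lborel. f (x + c)) = (LINT x|lborel. f x)"
proof -
  have f[measurable]: "f \<in> borel_measurable borel" using assms by auto
  have d: "distr lborel borel (\<lambda>x. x + c) = lborel"
  proof -
    have "(\<lambda>x. x + c) = (+) c" by (auto simp: add.commute)
    then show ?thesis by (simp only: lborel_distr_plus)
  qed
  have i: "integrable (distr lborel borel (\<lambda>x. x + c)) f" using assms d by simp
  then show "integrable lborel (\<lambda>x. f (x + c))" by (subst (asm) integrable_distr_eq) auto
  have "(LINT x|distr lborel borel (\<lambda>x. x + c). f x) = (LINT x|lborel. f (x + c))"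
    by (subst integral_distr) auto
  then show "(LINT x|lborel. f (x + c)) = (LINT x|lborel. f x)" using d by simp
qed

lemma integrable_continuous_compact_support:
  fixes f :: "'a::euclidean_space \<Rightarrow> real"
  assumes "compact K" "continuous_on K f" "\<And>x. x \<notin> K \<Longrightarrow> f x = 0"
  shows "integrable lborel f"
proof -
  have "integrable lborel (\<lambda>x. indicator K x *\<^sub>R f x)"
    using borel_integrable_compact[OF assms(1,2)] 
    by (rule Bochner_Integration.integrable_cong[THEN iffD1, rotated -1]) (auto simp: indicator_def)
  moreover have "(\<lambda>x. indicator K x *\<^sub>R f x) = f" using assms(3) by (intro ext) (auto simp: indicator_def)
  ultimately show ?thesis by simp
qed

text \<open>By translation invariance every difference quotient in direction \<open>e\<close> has
  integral zero, and the Lipschitz bound permits dominated convergence as the step shrinks. This is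
  integration by parts without iterated integrals. Continuity on \<open>K\<close> suits radial
  functions, which are handled on annuli.\<close>

lemma integral_dir_deriv_zero:
  fixes f :: "'a::euclidean_space \<Rightarrow> real"
  assumes K: "compact K" "continuous_on K f" "continuous_on K f'"
    and z: "\<And>x. x \<notin> K \<Longrightarrow> f x = 0" "\<And>x. x \<notin> K \<Longrightarrow> f' x = 0"
    and D: "\<And>x. ((\<lambda>t. f (x + t *\<^sub>R e)) has_real_derivative f' x) (at 0)"
  shows "integrable lborel f' \<and> (LINT x|lborel. f' x) = 0"
proof
  show "integrable lborel f'" using integrable_continuous_compact_support[OF K(1,3) z(2)] .
  have If: "integrable lborel f" using integrable_continuous_compact_support[OF K(1,2) z(1)] .
  have "bounded (f' ` K)" using K by (intro compact_imp_bounded compact_continuous_image)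
  then obtain M where "M > 0" "\<And>x. x \<in> K \<Longrightarrow> \<bar>f' x\<bar> \<le> M" by (auto simp: bounded_pos)
  with z have M: "\<bar>f' x\<bar> \<le> M" for x by (cases "x \<in> K") auto
  obtain B where B: "\<And>x. x \<in> K \<Longrightarrow> norm x \<le> B"
    using compact_imp_bounded[OF K(1)] by (auto simp: bounded_pos)
  define h where "h = (\<lambda>n. 1 / real (Suc n))"
  have h: "h \<longlonglongrightarrow> 0" "\<And>n. h n > 0" "\<And>n. h n \<le> 1"
    unfolding h_def using LIMSEQ_inverse_real_of_nat by (simp_all add: inverse_eq_divide)
  let ?q = "\<lambda>n x. (f (x + h n *\<^sub>R e) - f x) / h n"
  have "(\<lambda>n. LINT x|lborel. ?q n x) \<longlonglongrightarrow> (LINT x|lborel. f' x)"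
  proof (rule integral_dominated_convergence)
    show "f' \<in> borel_measurable lborel" using \<open>integrable lborel f'\<close> by auto
    show "?q n \<in> borel_measurable lborel" for n
      using borel_measurable_integrable[OF If] borel_measurable_integrable[OF lborel_integral_translate(1)[OF If]] by measurable
    \<comment> \<open>The steps satisfy \<open>h n \<le> 1\<close>, so enlarging the radius by
      \<open>norm e\<close> covers the supports of all the translates.\<close>
    show "integrable lborel (\<lambda>x. M * indicator (cball 0 (B + norm e)) x)"
      by (intro integrable_mult_right integrable_real_indicator) (use emeasure_bounded_finite[OF bounded_cball, of 0 "B + norm e"] in auto)
    show "AE x in lborel. (\<lambda>n. ?q n x) \<longlonglongrightarrow> f' x"
      using h by (intro AE_I2 dir_deriv_seq D) (auto simp: less_imp_neq[symmetric])
    show "AE x in lborel. norm (?q n x) \<le> M * indicator (cball 0 (B + norm e)) x" for n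
    proof (rule AE_I2)
      fix x
      have "\<bar>f (x + h n *\<^sub>R e) - f x\<bar> \<le> M * h n"
        using dir_deriv_lipschitz[OF D M, of x "h n"] h(2)[of n] by simp
      then have 1: "\<bar>?q n x\<bar> \<le> M" using h(2)[of n] by (simp add: divide_le_eq)
      have "?q n x = 0" if "x \<notin> cball 0 (B + norm e)"
      proof -
        have n: "norm x > B + norm e" using that by simp
        have "norm (h n *\<^sub>R e) \<le> norm e" using h(2,3)[of n] mult_right_mono[of "h n" 1 "norm e"] by simp
        then have "norm (x + h n *\<^sub>R e) > B" using n norm_triangle_ineq2[of x "- (h n *\<^sub>R e)"] by simp
        then have "f (x + h n *\<^sub>R e) = 0" using B z(1) by (meson not_le)
        moreover have "norm x > B" using n norm_ge_zero[of e] by linarith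
        then have "f x = 0" using B z(1) by (meson not_le)
        ultimately show ?thesis by simp
      qed
      with 1 show "norm (?q n x) \<le> M * indicator (cball 0 (B + norm e)) x"
        by (cases "x \<in> cball 0 (B + norm e)") auto
    qed
  qed
  moreover have "(LINT x|lborel. ?q n x) = 0" for n
    using lborel_integral_translate[OF If, of "h n *\<^sub>R e"] If by simp
  ultimately have "(\<lambda>n::nat. 0) \<longlonglongrightarrow> (LINT x|lborel. f' x)" by (simp only:)
  then show "(LINT x|lborel. f' x) = 0" by (simp add: LIMSEQ_const_iff)
qed

section \<open>Convolution of a locally integrable function with a test function\<close>

lemma L1_loc_mult_integrable:
  fixes u k :: "real^'n \<Rightarrow> real"
  assumes u: "u \<in> L1_loc" and k: "k \<in> borel_measurable borel" "\<And>x. \<bar>k x\<bar> \<le> M"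
    and z: "\<And>x. b < norm x \<Longrightarrow> k x = 0"
  shows "integrable lebesgue (\<lambda>y. u y * k y)"
proof -
  have "integrable lebesgue (\<lambda>y. indicator (cball 0 b) y *\<^sub>R u y)"
    using u compact_cball unfolding L1_loc_def set_integrable_def by blast
  then have i: "integrable lebesgue (\<lambda>y. M * (indicator (cball 0 b) y *\<^sub>R u y))"
    by (rule integrable_mult_right)
  have k': "k \<in> borel_measurable lebesgue" using k(1) by (simp add: measurable_completion)
  have eq: "u y * k y = (indicator (cball 0 b) y *\<^sub>R u y) * k y" for y
    using z[of y] by (auto simp: indicator_def)
  show ?thesis
  proof (rule Bochner_Integration.integrable_bound[OF i])
    show "(\<lambda>y. u y * k y) \<in> borel_measurable lebesgue"
      unfolding eq using \<open>integrable lebesgue (\<lambda>y. indicator (cball 0 b) y *\<^sub>R u y)\<close> k'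
      by (intro borel_measurable_times) auto
    have "\<bar>k y\<bar> * \<bar>u y\<bar> \<le> \<bar>M\<bar> * \<bar>u y\<bar>" for y
      using k(2)[of y] by (intro mult_right_mono) auto
    then show "AE y in lebesgue. norm (u y * k y) \<le> norm (M * (indicator (cball 0 b) y *\<^sub>R u y))"
      using z by (auto simp: abs_mult indicator_def mult.commute intro!: AE_I2)
  qed
qed

lemma test_fun_bounded:
  assumes "k \<in> test_fun" obtains M where "M > 0" "\<And>x. \<bar>k x\<bar> \<le> M"
proof -
  obtain b where b: "b > 0" "\<And>x. b \<le> norm x \<Longrightarrow> k x = 0" using test_funD(3)[OF assms] by blast
  have "bounded (k ` cball 0 b)"
    by (intro compact_imp_bounded compact_continuous_image continuous_on_subset[OF test_funD(2)[OF assms]]) auto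
  then obtain M where M: "M > 0" "\<And>x. x \<in> cball 0 b \<Longrightarrow> \<bar>k x\<bar> \<le> M" by (auto simp: bounded_pos)
  show ?thesis
    by (rule that[OF M(1)]) (use b(2) M in \<open>metis abs_zero linorder_le_cases mem_cball_0 less_imp_le\<close>)
qed

lemma L1_loc_test_integrable:
  fixes u :: "real^'n \<Rightarrow> real"
  assumes "u \<in> L1_loc" "k \<in> test_fun"
  shows "integrable lebesgue (\<lambda>y. u y * k y)"
proof -
  obtain M where M: "M > 0" "\<And>x. \<bar>k x\<bar> \<le> M" using test_fun_bounded[OF assms(2)] by blast
  obtain b where b: "b > 0" "\<And>x. b \<le> norm x \<Longrightarrow> k x = 0" using test_funD(3)[OF assms(2)] by blast
  show ?thesis
    by (rule L1_loc_mult_integrable[OF assms(1) borel_measurable_continuous_onI[OF test_funD(2)[OF assms(2)]] M(2), where b=b])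
      (use b in auto)
qed

definition conv :: "(real^'n \<Rightarrow> real) \<Rightarrow> (real^'n \<Rightarrow> real) \<Rightarrow> real^'n \<Rightarrow> real" where
  "conv u k x = (LINT y|lebesgue. u y * k (x - y))"

lemma conv_integrable:
  assumes "u \<in> L1_loc" "k \<in> test_fun"
  shows "integrable lebesgue (\<lambda>y. u y * k (x - y))"
  using L1_loc_test_integrable[OF assms(1) test_fun_reflect[OF assms(2)]] .

lemma continuous_on_conv:
  assumes u: "u \<in> L1_loc" and k: "k \<in> test_fun"
  shows "continuous_on UNIV (conv u k)"
proof -
  obtain M where M: "M > 0" "\<And>x. \<bar>k x\<bar> \<le> M" using test_fun_bounded[OF k] by blast
  obtain b where b: "b > 0" "\<And>x. b \<le> norm x \<Longrightarrow> k x = 0" using test_funD(3)[OF k] by blast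
  have "(\<lambda>n. conv u k (X n)) \<longlonglongrightarrow> conv u k x" if X: "X \<longlonglongrightarrow> x" for X x
  proof -
    have "Bseq X" using X convergentI convergent_imp_Bseq by blast
    then obtain R where R: "\<And>n. norm (X n) \<le> R" by (auto simp: Bseq_def)
    show ?thesis unfolding conv_def
    proof (rule integral_dominated_convergence)
      show "(\<lambda>y. u y * k (x - y)) \<in> borel_measurable lebesgue" using conv_integrable[OF u k] by auto
      show "(\<lambda>y. u y * k (X n - y)) \<in> borel_measurable lebesgue" for n using conv_integrable[OF u k] by auto
      show "integrable lebesgue (\<lambda>y. \<bar>u y * (M * indicator (cball 0 (R + b)) y)\<bar>)"
        by (intro integrable_abs L1_loc_mult_integrable[OF u, where M=M and b="R+b"])
          (use M in \<open>auto simp: indicator_def\<close>)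
      show "AE y in lebesgue. (\<lambda>n. u y * k (X n - y)) \<longlonglongrightarrow> u y * k (x - y)"
        using X by (intro AE_I2 tendsto_mult tendsto_const continuous_on_tendsto_compose[OF test_funD(2)[OF k]] tendsto_diff) auto
      show "AE y in lebesgue. norm (u y * k (X n - y)) \<le> \<bar>u y * (M * indicator (cball 0 (R + b)) y)\<bar>" for n
      proof (rule AE_I2)
        fix y
        have "k (X n - y) = 0" if "y \<notin> cball 0 (R + b)"
          using that b(2)[of "X n - y"] R[of n] norm_triangle_ineq2[of y "X n"] by (auto simp: norm_minus_commute)
        then show "norm (u y * k (X n - y)) \<le> \<bar>u y * (M * indicator (cball 0 (R + b)) y)\<bar>"
          using M by (auto simp: abs_mult indicator_def intro!: mult_left_mono)
      qed
    qed
  qed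
  then show ?thesis by (auto simp: continuous_on_sequentially o_def)
qed

text \<open>The derivative falls on the kernel. Its difference quotients are bounded by one
  constant, and a bounded sequence of steps keeps their supports in one ball, on which
  \<open>u\<close> is integrable.\<close>

lemma conv_dir_deriv:
  assumes u: "u \<in> L1_loc" and k: "k \<in> test_fun"
  shows "((\<lambda>t. conv u k (x + t *\<^sub>R e)) has_real_derivative
    conv u (\<lambda>z. frechet_derivative k (at z) e) x) (at 0)"
proof -
  let ?k = "\<lambda>z. frechet_derivative k (at z) e"
  note k' = test_fun_deriv[OF k, of e]
  have D: "((\<lambda>t. k (z + t *\<^sub>R e)) has_real_derivative ?k z) (at 0)" for z
    by (rule has_derivative_imp_dir[OF test_funD(1)[OF k]])
  obtain M where M: "M > 0" "\<And>x. \<bar>?k x\<bar> \<le> M" using test_fun_bounded[OF k'] by blast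
  obtain b where b: "b > 0" "\<And>x. b \<le> norm x \<Longrightarrow> k x = 0" using test_funD(3)[OF k] by blast
  have "(\<lambda>n. (conv u k (x + h n *\<^sub>R e) - conv u k x) / h n) \<longlonglongrightarrow> conv u ?k x"
    if h: "h \<longlonglongrightarrow> 0" "\<And>n. h n \<noteq> 0" for h :: "nat \<Rightarrow> real"
  proof -
    have "Bseq h" using h convergentI convergent_imp_Bseq by blast
    then obtain R where R: "R > 0" "\<And>n. \<bar>h n\<bar> \<le> R" by (auto simp: Bseq_def)
    define B where "B = norm x + R * norm e + b"
    have B: "norm x + b \<le> B" "norm (x + h n *\<^sub>R e) + b \<le> B" for n
    proof -
      have "norm (h n *\<^sub>R e) \<le> R * norm e" using R(2)[of n] by (simp add: mult_right_mono)
      then show "norm (x + h n *\<^sub>R e) + b \<le> B"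
        unfolding B_def using norm_triangle_ineq[of x "h n *\<^sub>R e"] by linarith
      show "norm x + b \<le> B" unfolding B_def using R(1) by simp
    qed
    let ?q = "\<lambda>n y. u y * ((k (x - y + h n *\<^sub>R e) - k (x - y)) / h n)"
    have I: "integrable lebesgue (\<lambda>y. u y * k (x + h n *\<^sub>R e - y))" for n by (rule conv_integrable[OF u k])
    have qe: "?q n = (\<lambda>y. (u y * k (x + h n *\<^sub>R e - y) - u y * k (x - y)) / h n)" for n
      by (auto simp: field_simps h)
    have eq: "(conv u k (x + h n *\<^sub>R e) - conv u k x) / h n = (LINT y|lebesgue. ?q n y)" for n
      unfolding conv_def qe using I conv_integrable[OF u k, of x] by simp
    have "(\<lambda>n. LINT y|lebesgue. ?q n y) \<longlonglongrightarrow> conv u ?k x"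
      unfolding conv_def
    proof (rule integral_dominated_convergence)
      show "(\<lambda>y. u y * ?k (x - y)) \<in> borel_measurable lebesgue" using conv_integrable[OF u k'] by auto
      have "integrable lebesgue (?q n)" for n
        unfolding qe using I conv_integrable[OF u k, of x] by simp
      then show "?q n \<in> borel_measurable lebesgue" for n by auto
      show "integrable lebesgue (\<lambda>y. \<bar>u y * (M * indicator (cball 0 B) y)\<bar>)"
        by (intro integrable_abs L1_loc_mult_integrable[OF u, where M=M and b=B])
          (use M in \<open>auto simp: indicator_def\<close>)
      show "AE y in lebesgue. (\<lambda>n. ?q n y) \<longlonglongrightarrow> u y * ?k (x - y)"
        using h by (intro AE_I2 tendsto_mult tendsto_const dir_deriv_seq D) auto
      show "AE y in lebesgue. norm (?q n y) \<le> \<bar>u y * (M * indicator (cball 0 B) y)\<bar>" for n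
      proof (rule AE_I2)
        fix y
        have "\<bar>k (x - y + h n *\<^sub>R e) - k (x - y)\<bar> \<le> M * \<bar>h n\<bar>" 
          using dir_deriv_lipschitz[OF D M(2)] by blast
        then have 1: "\<bar>(k (x - y + h n *\<^sub>R e) - k (x - y)) / h n\<bar> \<le> M"
          using h(2)[of n] by (simp add: divide_le_eq)
        have "k (x - y + h n *\<^sub>R e) = 0 \<and> k (x - y) = 0" if "y \<notin> cball 0 B"
        proof -
          have "norm y > B" using that by simp
          then have "b \<le> norm (x - y)" "b \<le> norm (x + h n *\<^sub>R e - y)"
            using B(1) B(2)[of n] norm_triangle_ineq2[of y x] norm_triangle_ineq2[of y "x + h n *\<^sub>R e"]
            by (auto simp: norm_minus_commute)
          then show ?thesis using b(2) by (auto simp: algebra_simps)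
        qed
        with 1 show "norm (?q n y) \<le> \<bar>u y * (M * indicator (cball 0 B) y)\<bar>"
          using M(1) mult_left_mono[OF 1, of "\<bar>u y\<bar>"] by (cases "y \<in> cball 0 B") (auto simp: abs_mult)
      qed
    qed
    then show ?thesis by (simp add: eq)
  qed
  then show ?thesis
    by (auto simp: DERIV_def tendsto_at_iff_sequentially o_def)
qed

subsection \<open>Positive supersolutions and Hardy test functions\<close>

text \<open>A classical solution of -\<Delta>U \<ge> qU on \<open>K\<close>. Coordinatewise
  derivatives suffice for the divergence argument. The inequality is local to \<open>K\<close>
  because the radius of the kernel that produces \<open>U\<close> depends on \<open>K\<close>;
  hiding \<open>U\<close> behind the quantifier allows a different one for each
  \<open>K\<close>.\<close>

definition positive_supersol :: "(real^'n) set \<Rightarrow> (real^'n \<Rightarrow> real) \<Rightarrow> bool" where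
  "positive_supersol K q \<longleftrightarrow> (\<exists>U dU ddU.
     (\<forall>x. U x > 0) \<and> continuous_on UNIV U \<and>
     (\<forall>i. continuous_on UNIV (dU i) \<and> continuous_on UNIV (ddU i)) \<and>
     (\<forall>i x. ((\<lambda>t. U (x + t *\<^sub>R axis i 1)) has_real_derivative dU i x) (at 0)) \<and>
     (\<forall>i x. ((\<lambda>t. dU i (x + t *\<^sub>R axis i 1)) has_real_derivative ddU i x) (at 0)) \<and>
     (\<forall>x\<in>K. q x * U x \<le> - (\<Sum>i\<in>UNIV. ddU i x)))"

text \<open>Integrate the divergence of \<open>\<phi>\<^sup>2\<nabla>U/U\<close> and complete the square.\<close>

lemma positive_supersol_test:
  fixes q :: "real^'n \<Rightarrow> real"
  assumes K: "compact K" and S: "positive_supersol K q" and q: "continuous_on UNIV q"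
    and \<phi>: "continuous_on K \<phi>" "\<And>i. continuous_on K (d\<phi> i)"
    and z: "\<And>x. x \<notin> K \<Longrightarrow> \<phi> x = 0" "\<And>i x. x \<notin> K \<Longrightarrow> d\<phi> i x = 0"
    and D: "\<And>i x. ((\<lambda>t. \<phi> (x + t *\<^sub>R axis i 1)) has_real_derivative d\<phi> i x) (at 0)"
  shows "(LINT x|lborel. q x * (\<phi> x)\<^sup>2) \<le> (LINT x|lborel. (\<Sum>i\<in>UNIV. (d\<phi> i x)\<^sup>2))"
proof -
  obtain U dU ddU where U: "\<And>x. U x > 0" "continuous_on UNIV U"
    "\<And>i. continuous_on UNIV (dU i)" "\<And>i. continuous_on UNIV (ddU i)"
    "\<And>i x. ((\<lambda>t. U (x + t *\<^sub>R axis i 1)) has_real_derivative dU i x) (at 0)"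
    "\<And>i x. ((\<lambda>t. dU i (x + t *\<^sub>R axis i 1)) has_real_derivative ddU i x) (at 0)"
    "\<And>x. x \<in> K \<Longrightarrow> q x * U x \<le> - (\<Sum>i\<in>UNIV. ddU i x)"
    using S unfolding positive_supersol_def by blast
  have U0: "U x \<noteq> 0" for x using U(1)[of x] by simp
  have cK: "continuous_on K U" "continuous_on K (dU i)" "continuous_on K (ddU i)" "continuous_on K q" for i
    using U(2,3,4) q by (auto intro: continuous_on_subset)
  let ?f = "\<lambda>i x. (\<phi> x)\<^sup>2 * dU i x / U x"
  let ?f' = "\<lambda>i x. 2 * \<phi> x * d\<phi> i x * dU i x / U x + (\<phi> x)\<^sup>2 * ddU i x / U x - (\<phi> x)\<^sup>2 * (dU i x)\<^sup>2 / (U x)\<^sup>2"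
  have f': "integrable lborel (?f' i) \<and> (LINT x|lborel. ?f' i x) = 0" for i
  proof (rule integral_dir_deriv_zero[OF K, where f = "?f i" and e = "axis i 1"])
    show "((\<lambda>t. ?f i (x + t *\<^sub>R axis i 1)) has_real_derivative ?f' i x) (at 0)" for x
    proof (rule DERIV_cong)
      show "((\<lambda>t. ?f i (x + t *\<^sub>R axis i 1)) has_real_derivative
        ((2 * \<phi> x * d\<phi> i x * dU i x + (\<phi> x)\<^sup>2 * ddU i x) * U x - ((\<phi> x)\<^sup>2 * dU i x) * dU i x) / (U x * U x)) (at 0)"
        using U0 by (auto intro!: derivative_eq_intros D U(5,6))
      show "((2 * \<phi> x * d\<phi> i x * dU i x + (\<phi> x)\<^sup>2 * ddU i x) * U x - ((\<phi> x)\<^sup>2 * dU i x) * dU i x) / (U x * U x)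
         = ?f' i x"
        using U0[of x] by (simp add: field_simps power2_eq_square)
    qed
  qed (use U0 z in \<open>auto intro!: continuous_intros \<phi> cK\<close>)
  have pw: "q x * (\<phi> x)\<^sup>2 \<le> (\<Sum>i\<in>UNIV. (d\<phi> i x)\<^sup>2) - (\<Sum>i\<in>UNIV. ?f' i x)" for x
  proof (cases "x \<in> K")
    case True
    have "q x \<le> - (\<Sum>i\<in>UNIV. ddU i x) / U x" 
      using U(7)[OF True] unfolding pos_le_divide_eq[OF U(1)] .
    then have "q x * (\<phi> x)\<^sup>2 \<le> - (\<Sum>i\<in>UNIV. ddU i x) / U x * (\<phi> x)\<^sup>2"
      by (intro mult_right_mono) auto
    also have "\<dots> = (\<Sum>i\<in>UNIV. - ((\<phi> x)\<^sup>2 * ddU i x / U x))"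
      by (simp add: sum_negf sum_distrib_left sum_divide_distrib mult.commute)
    also have "\<dots> \<le> (\<Sum>i\<in>UNIV. (d\<phi> i x)\<^sup>2 - ?f' i x)"
    proof (rule sum_mono)
      fix i
      have "0 \<le> (d\<phi> i x - \<phi> x * (dU i x / U x))\<^sup>2" by simp
      also have "\<dots> = (d\<phi> i x)\<^sup>2 - 2 * \<phi> x * d\<phi> i x * dU i x / U x + (\<phi> x)\<^sup>2 * (dU i x)\<^sup>2 / (U x)\<^sup>2"
        using U0[of x] by (simp add: power2_eq_square field_simps)
      finally show "- ((\<phi> x)\<^sup>2 * ddU i x / U x) \<le> (d\<phi> i x)\<^sup>2 - ?f' i x" by linarith
    qed
    finally show ?thesis by (simp add: sum_subtractf)
  qed (use z in auto)
  have I1: "integrable lborel (\<lambda>x. q x * (\<phi> x)\<^sup>2)"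
    by (rule integrable_continuous_compact_support[OF K]) (auto intro!: continuous_intros \<phi> cK simp: z)
  have I2: "integrable lborel (\<lambda>x. (\<Sum>i\<in>UNIV. (d\<phi> i x)\<^sup>2))"
    by (rule integrable_continuous_compact_support[OF K]) (auto intro!: continuous_intros \<phi> cK simp: z)
  have I3: "integrable lborel (\<lambda>x. \<Sum>i\<in>UNIV. ?f' i x)"
    by (intro Bochner_Integration.integrable_sum) (use f' in blast)
  have "(LINT x|lborel. q x * (\<phi> x)\<^sup>2) \<le> (LINT x|lborel. (\<Sum>i\<in>UNIV. (d\<phi> i x)\<^sup>2) - (\<Sum>i\<in>UNIV. ?f' i x))"
    by (rule integral_mono[OF I1 _ pw]) (intro Bochner_Integration.integrable_diff I2 I3)
  also have "\<dots> = (LINT x|lborel. (\<Sum>i\<in>UNIV. (d\<phi> i x)\<^sup>2)) - (LINT x|lborel. (\<Sum>i\<in>UNIV. ?f' i x))"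
    by (rule Bochner_Integration.integral_diff[OF I2 I3])
  also have "(LINT x|lborel. (\<Sum>i\<in>UNIV. ?f' i x)) = (\<Sum>i\<in>UNIV. LINT x|lborel. ?f' i x)"
    by (rule Bochner_Integration.integral_sum) (use f' in blast)
  also have "\<dots> = 0" using f' by (intro sum.neutral) blast
  finally show ?thesis by simp
qed

text \<open>Radial functions are written in the variable \<open>ln |x|\<close>. The value at the origin is set to \<open>0\<close>
  because \<open>ln 0 = 0\<close> would otherwise produce the junk value \<open>H 0\<close>.\<close>

definition rad :: "(real \<Rightarrow> real) \<Rightarrow> real^'n \<Rightarrow> real" where
  "rad H x = (if x = 0 then 0 else H (ln (norm x)))"

definition annulus :: "real \<Rightarrow> real \<Rightarrow> (real^'n) set" where
  "annulus a b = {x. exp a \<le> norm x \<and> norm x \<le> exp b}"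

lemma compact_annulus: "compact (annulus a b :: (real^'n) set)"
proof -
  have "(annulus a b :: (real^'n) set) = cball 0 (exp b) - ball 0 (exp a)" by (auto simp: annulus_def not_less)
  then show ?thesis by (simp add: compact_diff)
qed

lemma annulus_nonzero: "x \<in> annulus a b \<Longrightarrow> x \<noteq> 0"
  by (auto simp: annulus_def)

lemma continuous_on_rad:
  assumes "continuous_on UNIV H"
  shows "continuous_on (annulus a b) (rad H)"
proof -
  have "continuous_on (annulus a b) (\<lambda>x. H (ln (norm x)))"
    by (intro continuous_on_compose2[OF assms] continuous_intros) (auto dest: annulus_nonzero)
  then show ?thesis
    by (rule continuous_on_eq) (auto simp: rad_def dest: annulus_nonzero)
qed

lemma rad_outside:
  assumes "\<And>l. l \<notin> {a..b} \<Longrightarrow> H l = 0" "x \<notin> annulus a b"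
  shows "rad H x = 0"
proof -
  have "H (ln (norm x)) = 0" if "x \<noteq> 0"
  proof (rule assms(1))
    show "ln (norm x) \<notin> {a..b}"
      using assms(2) that by (auto simp: annulus_def ln_ge_iff) (metis exp_le_cancel_iff exp_ln zero_less_norm_iff)
  qed
  then show ?thesis by (auto simp: rad_def)
qed

text \<open>The gradient of ln |x| is x/|x|^2. Since \<open>H\<close> vanishes below
  \<open>a\<close>, \<open>rad H\<close> is zero near the origin, where the formula holds with value
  0.\<close>

lemma rad_dir_deriv:
  assumes H: "\<And>l. (H has_real_derivative H' l) (at l)"
    and z: "\<And>l. l \<notin> {a..b} \<Longrightarrow> H l = 0"
  shows "((\<lambda>t. rad H (x + t *\<^sub>R e)) has_real_derivative rad H' x * (x \<bullet> e) / (norm x)\<^sup>2) (at 0)"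
proof (cases "x = 0")
  case True
  have "isCont (\<lambda>t::real. norm (x + t *\<^sub>R e)) 0" by (intro continuous_intros)
  then have "((\<lambda>t::real. norm (x + t *\<^sub>R e)) \<longlongrightarrow> norm (x + 0 *\<^sub>R e)) (nhds 0)"
    using tendsto_at_iff_tendsto_nhds[of "\<lambda>t::real. norm (x + t *\<^sub>R e)" 0] by (simp only: isCont_def)
  then have "((\<lambda>t::real. norm (x + t *\<^sub>R e)) \<longlongrightarrow> 0) (nhds 0)" using True by simp
  then have "\<forall>\<^sub>F t::real in nhds 0. norm (x + t *\<^sub>R e) < exp a" by (rule order_tendstoD) simp
  then have "\<forall>\<^sub>F t in nhds 0. rad H (x + t *\<^sub>R e) = 0"
    by eventually_elim (intro rad_outside[of a b], auto simp: z annulus_def)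
  from DERIV_cong_ev[OF refl this refl] show ?thesis using True by (simp add: rad_def)
next
  case False
  have "isCont (\<lambda>t::real. x + t *\<^sub>R e) 0" by (intro continuous_intros)
  then have "((\<lambda>t::real. x + t *\<^sub>R e) \<longlongrightarrow> x + 0 *\<^sub>R e) (nhds 0)"
    using tendsto_at_iff_tendsto_nhds[of "\<lambda>t::real. x + t *\<^sub>R e" 0] by (simp only: isCont_def)
  then have "((\<lambda>t::real. x + t *\<^sub>R e) \<longlongrightarrow> x) (nhds 0)" by simp
  then have "\<forall>\<^sub>F t::real in nhds 0. x + t *\<^sub>R e \<in> - {0}" 
    using False by (intro topological_tendstoD) auto
  then have ev: "\<forall>\<^sub>F t in nhds 0. rad H (x + t *\<^sub>R e) = H (ln (norm (x + t *\<^sub>R e)))"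
    by eventually_elim (auto simp: rad_def)
  have "((\<lambda>x. ln (norm x)) has_derivative (\<lambda>v. (x \<bullet> v) / norm x / norm x)) (at x)"
    using False by (auto intro!: derivative_eq_intros has_derivative_norm simp: sgn_div_norm field_simps inner_commute)
  from has_derivative_imp_dir[OF this]
  have "((\<lambda>t. ln (norm (x + t *\<^sub>R e))) has_real_derivative (x \<bullet> e) / norm x / norm x) (at 0)" .
  from DERIV_chain2[OF _ this, of H] H
  have "((\<lambda>t. H (ln (norm (x + t *\<^sub>R e)))) has_real_derivative H' (ln (norm x)) * ((x \<bullet> e) / norm x / norm x)) (at 0)"
    by simp
  with DERIV_cong_ev[OF refl ev refl] show ?thesis
    using False by (simp add: rad_def power2_eq_square)
qed

text \<open>The divergence of \<open>x |x|\<^sup>-\<^sup>N h(ln |x|)\<close> is \<open>|x|\<^sup>-\<^sup>N h'(ln |x|)\<close>; this replaces polar coordinates.\<close>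

lemma rad_divergence:
  assumes h: "\<And>l. (h has_real_derivative h' l) (at l)" and c: "continuous_on UNIV h'"
    and z: "\<And>l. l \<notin> {a..b} \<Longrightarrow> h l = 0" "\<And>l. l \<notin> {a..b} \<Longrightarrow> h' l = 0"
  shows "(LINT x|lborel. rad (\<lambda>l. exp (- real CARD('n) * l) * h' l) (x::real^'n)) = 0"
proof -
  let ?N = "real CARD('n)"
  let ?H = "\<lambda>l. exp (- ?N * l) * h l"
  let ?H' = "\<lambda>l. exp (- ?N * l) * (h' l - ?N * h l)"
  have ch: "continuous_on UNIV h" using h by (auto intro!: continuous_at_imp_continuous_on DERIV_isCont)
  have H: "(?H has_real_derivative ?H' l) (at l)" for l
    by (auto intro!: derivative_eq_intros h simp: algebra_simps)
  have CH: "continuous_on (annulus a b :: (real^'n) set) (rad ?H)"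
      "continuous_on (annulus a b :: (real^'n) set) (rad ?H')"
    by (intro continuous_on_rad continuous_intros ch c)+
  have ZH: "x \<notin> annulus a b \<Longrightarrow> rad ?H x = 0" "x \<notin> annulus a b \<Longrightarrow> rad ?H' x = 0" for x :: "real^'n"
    using z by (auto intro!: rad_outside[of a b])
  let ?f = "\<lambda>(i::'n) x. x $ i * rad ?H x"
  let ?f' = "\<lambda>(i::'n) x. rad ?H x + x $ i * (rad ?H' x * (x $ i) / (norm x)\<^sup>2)"
  have f': "integrable lborel (?f' i) \<and> (LINT x|lborel. ?f' i x) = 0" for i
  proof (rule integral_dir_deriv_zero[OF compact_annulus, where f = "?f i" and e = "axis i 1"])
    show "((\<lambda>t. ?f i (x + t *\<^sub>R axis i 1)) has_real_derivative ?f' i x) (at 0)" for x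
      using rad_dir_deriv[OF H, of a b x "axis i 1"] z(1)
      by (auto intro!: derivative_eq_intros simp: inner_axis)
  qed (use ZH CH in \<open>auto intro!: continuous_intros dest: annulus_nonzero\<close>)
  have "rad (\<lambda>l. exp (- ?N * l) * h' l) x = (\<Sum>i\<in>UNIV. ?f' i x)" for x :: "real^'n"
  proof (cases "x = 0")
    case False
    have "(norm x)\<^sup>2 = (\<Sum>i\<in>UNIV. x $ i * x $ i)"
      unfolding power2_norm_eq_inner inner_vec_def by simp
    have "(\<Sum>i\<in>UNIV. x $ i * (rad ?H' x * (x $ i) / (norm x)\<^sup>2)) = (\<Sum>i\<in>UNIV. x $ i * x $ i) * (rad ?H' x / (norm x)\<^sup>2)"
      unfolding sum_distrib_right by (intro sum.cong) auto
    also have "\<dots> = rad ?H' x"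
      using False by (simp flip: \<open>(norm x)\<^sup>2 = _\<close>)
    \<comment> \<open>The derivatives of the coordinates contribute N copies of
      \<open>rad ?H x\<close>, and these cancel the term \<open>- ?N * h l\<close> of
      \<open>?H'\<close>.\<close>
    finally show ?thesis using False by (simp add: sum.distrib rad_def algebra_simps)
  qed (simp add: rad_def)
  then have "(LINT x|lborel. rad (\<lambda>l. exp (- ?N * l) * h' l) (x::real^'n)) = (LINT x|lborel. (\<Sum>i\<in>UNIV. ?f' i x))"
    by (simp only:)
  also have "\<dots> = (\<Sum>i\<in>UNIV. LINT x|lborel. ?f' i x)"
    by (rule Bochner_Integration.integral_sum) (use f' in blast)
  also have "\<dots> = 0" using f' by (intro sum.neutral) blast
  finally show ?thesis .
qed

section \<open>The cutoff in the logarithmic variable\<close>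

lemma DERIV_pos_part_power:
  "((\<lambda>y::real. (max 0 y) ^ (k + 2)) has_real_derivative real (k + 2) * (max 0 y) ^ (k + 1)) (at y)"
proof -
  consider "y < 0" | "y = 0" | "y > 0" by linarith
  then show ?thesis
  proof cases
    case 1
    then have "\<forall>\<^sub>F x in nhds y. x < 0" by (intro order_tendstoD[of "\<lambda>x. x"]) (auto simp: filterlim_ident)
    then have ev: "\<forall>\<^sub>F x in nhds y. (max 0 x) ^ (k + 2) = 0" by eventually_elim auto
    show ?thesis using DERIV_cong_ev[OF refl ev refl] 1 by simp
  next
    case 2
    have "((\<lambda>h::real. (max 0 h) ^ (k + 1)) \<longlongrightarrow> (max 0 0) ^ (k + 1)) (at 0)"
      by (intro tendsto_intros)
    then have "((\<lambda>h::real. (max 0 h) ^ (k + 1)) \<longlongrightarrow> 0) (at 0)" by simp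
    then have "((\<lambda>h::real. (max 0 h) ^ (k + 2) / h) \<longlongrightarrow> 0) (at 0)"
      by (rule Lim_transform_eventually) (auto simp: eventually_at_filter max_def)
    then show ?thesis using 2 by (simp add: DERIV_def)
  next
    case 3
    then have "\<forall>\<^sub>F x in nhds y. x > 0" by (intro order_tendstoD[of "\<lambda>x. x"]) (auto simp: filterlim_ident)
    then have ev: "\<forall>\<^sub>F x in nhds y. (max 0 x) ^ (k + 2) = x ^ (k + 2)" by eventually_elim auto
    have "((\<lambda>x. x ^ (k + 2)) has_real_derivative real (k + 2) * (max 0 y) ^ (k + 1)) (at y)"
      using 3 DERIV_pow[of "k + 2" y] by (simp add: max_def)
    then show ?thesis using DERIV_cong_ev[OF refl ev refl] by simp
  qed
qed

text \<open>A polynomial profile turns the identity behind \<open>hardy_test\<close> into algebra.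
  The cap has corners at T and -T, so only its powers with exponent at least 2 are
  differentiated.\<close>

definition cap :: "real \<Rightarrow> real \<Rightarrow> real" where
  "cap T t = max 0 (T\<^sup>2 - t\<^sup>2)"

lemma DERIV_cap_power:
  "((\<lambda>l. cap T (l - c) ^ (k + 2)) has_real_derivative - 2 * real (k + 2) * (l - c) * cap T (l - c) ^ (k + 1)) (at l)"
proof -
  have "((\<lambda>l. T\<^sup>2 - (l - c)\<^sup>2) has_real_derivative - 2 * (l - c)) (at l)"
    by (auto intro!: derivative_eq_intros)
  from DERIV_chain2[OF DERIV_pos_part_power this] show ?thesis
    unfolding cap_def by (simp add: algebra_simps)
qed

lemma cap_outside: "T > 0 \<Longrightarrow> l \<notin> {c - T..c + T} \<Longrightarrow> cap T (l - c) = 0"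
  using power_strict_mono[of T "\<bar>l - c\<bar>" 2] by (auto simp: cap_def max_def abs_if power2_commute split: if_splits)

lemma continuous_on_cap: "continuous_on A (\<lambda>l. cap T (l - c))"
  unfolding cap_def by (intro continuous_intros)

text \<open>The test function is \<open>|x|\<^sup>-\<^sup>s P\<^sup>2\<close> with \<open>P = cap T (ln |x| - c)\<close>. The function \<open>h\<close> in the proof is
  chosen such that \<open>(g' - sg)\<^sup>2 = (s\<^sup>2 + 3/T\<^sup>2)g\<^sup>2 + h'\<close> for \<open>g = P\<^sup>2\<close>, so that the term
  \<open>h'\<close> integrates to zero.\<close>

lemma hardy_test:
  fixes q :: "real^'n \<Rightarrow> real"
  assumes T: "T > 0" and q: "continuous_on UNIV q" and s: "2 * s = real CARD('n) - 2"
    and S: "positive_supersol (annulus (c - T) (c + T)) q"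
  shows "(LINT x|lborel. q x * rad (\<lambda>l. exp (- 2 * s * l) * cap T (l - c) ^ 4) x)
    \<le> (s\<^sup>2 + 3 / T\<^sup>2) * (LINT x|lborel. rad (\<lambda>l. exp (- real CARD('n) * l) * cap T (l - c) ^ 4) (x::real^'n))"
proof -
  let ?N = "real CARD('n)"
  let ?P = "\<lambda>l. cap T (l - c)"
  let ?K = "annulus (c - T) (c + T) :: (real^'n) set"
  note out = cap_outside[OF T, of _ c]
  let ?H = "\<lambda>l. exp (- s * l) * ?P l ^ 2"
  let ?H' = "\<lambda>l. exp (- s * l) * (- 4 * (l - c) * ?P l - s * ?P l ^ 2)"
  define d where "d = 1 / (3 * T\<^sup>2)"
  \<comment> \<open>Opaque names for the powers: the derivative rules then use the formulas below
    instead of the power rule, which would ask for a derivative of \<open>cap\<close> at its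
    corners.\<close>
  define Q where "Q = (\<lambda>k l. ?P l ^ k)"
  have Q: "(Q 2 has_real_derivative - 4 * (l - c) * ?P l) (at l)"
    "(Q 3 has_real_derivative - 6 * (l - c) * ?P l ^ 2) (at l)"
    "(Q 4 has_real_derivative - 8 * (l - c) * ?P l ^ 3) (at l)" for l
    using DERIV_cap_power[of T c 0 l] DERIV_cap_power[of T c 1 l] DERIV_cap_power[of T c 2 l]
    by (simp_all add: Q_def numeral_eq_Suc)
  have "((\<lambda>l. exp (- s * l) * Q 2 l) has_real_derivative ?H' l) (at l)" for l
    by (auto intro!: derivative_eq_intros Q simp: algebra_simps) (simp add: Q_def algebra_simps)
  then have H: "(?H has_real_derivative ?H' l) (at l)" for l by (simp add: Q_def)
  have "(LINT x|lborel. q x * (rad ?H x)\<^sup>2) \<le>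
     (LINT x::real^'n|lborel. (\<Sum>i\<in>UNIV. (rad ?H' x * (x \<bullet> axis i 1) / (norm x)\<^sup>2)\<^sup>2))"
  proof (rule positive_supersol_test[OF compact_annulus S q, where \<phi> = "rad ?H"
        and d\<phi> = "\<lambda>i x. rad ?H' x * (x \<bullet> axis i 1) / (norm x)\<^sup>2"])
    show "((\<lambda>t. rad ?H (x + t *\<^sub>R axis i 1)) has_real_derivative
          rad ?H' x * (x \<bullet> axis i 1) / (norm x)\<^sup>2) (at 0)" for i and x :: "real^'n"
      by (rule rad_dir_deriv[OF H]) (use out in auto)
    show "continuous_on ?K (rad ?H)"
      by (intro continuous_on_rad continuous_intros continuous_on_cap)
    show "continuous_on ?K (\<lambda>x. rad ?H' x * (x \<bullet> axis i 1) / (norm x)\<^sup>2)" for i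
      by (intro continuous_on_rad continuous_intros continuous_on_cap) (auto dest: annulus_nonzero)
    show "rad ?H x = 0" if "x \<notin> ?K" for x
      by (rule rad_outside[OF _ that]) (use out in auto)
    have "rad ?H' x = 0" if "x \<notin> ?K" for x
      by (rule rad_outside[OF _ that]) (use out in auto)
    then show "rad ?H' x * (x \<bullet> axis i 1) / (norm x)\<^sup>2 = 0" if "x \<notin> ?K" for i x
      using that by simp
  qed
  moreover have "(rad ?H x)\<^sup>2 = rad (\<lambda>l. exp (- 2 * s * l) * ?P l ^ 4) x" for x :: "real^'n"
    by (simp add: rad_def power_mult_distrib flip: power_mult exp_double)
  moreover
  \<comment> \<open>Write t for l - c. The term with \<open>?P l ^ 3\<close> trades 16 t^2 P^2,
    which is g'^2, for a multiple of P^3; the term with factor \<open>d\<close> trades that for P^4,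
    using t^2 = T^2 - P; the last term absorbs the cross term -2sgg'. What remains is the constant
    3/T^2, the quotient of the integrals of g'^2 and g^2 for g = (T^2 - t^2)^2 over [-T, T].\<close>
  let ?h = "\<lambda>l. - (8/3) * ((l - c) * ?P l ^ 3) - (l - c) * ?P l ^ 4 * d - s * ?P l ^ 4"
  let ?h' = "\<lambda>l. - (8/3) * (?P l ^ 3 - 6 * (l - c)\<^sup>2 * ?P l ^ 2) - (?P l ^ 4 - 8 * (l - c)\<^sup>2 * ?P l ^ 3) * d
     + 8 * s * (l - c) * ?P l ^ 3"
  have "(\<Sum>i\<in>UNIV. (rad ?H' x * (x \<bullet> axis i 1) / (norm x)\<^sup>2)\<^sup>2)
     = (s\<^sup>2 + 3 / T\<^sup>2) * rad (\<lambda>l. exp (- ?N * l) * ?P l ^ 4) x + rad (\<lambda>l. exp (- ?N * l) * ?h' l) x"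
    (is "?lhs = ?rhs") for x :: "real^'n"
  proof (cases "x = 0")
    case False
    define l where "l = ln (norm x)"
    have n: "norm x = exp l" using False by (simp add: l_def)
    have x2: "(norm x)\<^sup>2 = (\<Sum>i\<in>UNIV. x $ i * x $ i)"
      unfolding power2_norm_eq_inner inner_vec_def by simp
    have "?lhs = (\<Sum>i\<in>UNIV. (x $ i * x $ i)) * ((?H' l)\<^sup>2 / ((norm x)\<^sup>2 * (norm x)\<^sup>2))"
      unfolding sum_distrib_right using False
      by (intro sum.cong) (auto simp: rad_def inner_axis l_def power2_eq_square)
    also have "\<dots> = (?H' l)\<^sup>2 / (norm x)\<^sup>2"
    proof -
      have cancel: "a * (b / (a * a)) = b / a" if "a \<noteq> 0" for a b :: real using that by simp
      show ?thesis unfolding x2[symmetric] by (rule cancel) (use False in simp)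
    qed
    also have "\<dots> = exp (- ?N * l) * (- 4 * (l - c) * ?P l - s * ?P l ^ 2)\<^sup>2"
    proof -
      \<comment> \<open>Criticality of \<open>s\<close>: |x|^(-2s) times the 1/|x|^2 of the squared
        gradient is the scale-invariant density |x|^(-N).\<close>
      have "- ?N * l = 2 * (- s * l) - 2 * l" using s by algebra
      then have "exp (- ?N * l) = exp (- s * l) ^ 2 / exp l ^ 2"
        by (simp only: exp_diff exp_double)
      then show ?thesis by (simp add: n power_mult_distrib)
    qed
    also have "(- 4 * (l - c) * ?P l - s * ?P l ^ 2)\<^sup>2 = (s\<^sup>2 + 3 / T\<^sup>2) * ?P l ^ 4 + ?h' l"
    proof (cases "?P l = 0")
      case False
      define t where "t = l - c"
      define p where "p = ?P l"
      have p: "p = T\<^sup>2 - t\<^sup>2" using False by (auto simp: p_def t_def cap_def max_def split: if_splits)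
      \<comment> \<open>The two sides differ by a multiple of p - T^2 + t^2, which is zero where the
        maximum in \<open>cap\<close> is not 0.\<close>
      have "(s\<^sup>2 + 3 / T\<^sup>2) * p ^ 4 + (- (8/3) * (p ^ 3 - 6 * t\<^sup>2 * p ^ 2) - (p ^ 4 - 8 * t\<^sup>2 * p ^ 3) * d
           + 8 * s * t * p ^ 3) - (- 4 * t * p - s * p ^ 2)\<^sup>2 = 8 / (3 * T\<^sup>2) * p ^ 3 * (p - T\<^sup>2 + t\<^sup>2)"
        using T by (simp add: d_def field_simps) algebra
      also have "\<dots> = 0" using p by simp
      finally show ?thesis by (simp add: t_def p_def)
    qed simp
    finally show ?thesis using False by (simp add: rad_def l_def algebra_simps)
  qed (simp add: rad_def)
  moreover have "(LINT x|lborel. rad (\<lambda>l. exp (- ?N * l) * ?h' l) (x::real^'n)) = 0"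
  proof (rule rad_divergence[where h = ?h and a = "c - T" and b = "c + T"])
    have "((\<lambda>l. a * ((l - c) * Q 3 l) - (l - c) * Q 4 l * d - s * Q 4 l) has_real_derivative
       (a * (Q 3 l + (l - c) * (- 6 * (l - c) * ?P l ^ 2))
        - (Q 4 l + (l - c) * (- 8 * (l - c) * ?P l ^ 3)) * d - s * (- 8 * (l - c) * ?P l ^ 3))) (at l)" for a l
      by (auto intro!: derivative_eq_intros Q simp: algebra_simps)
    from this[of "- (8/3)"] show "(?h has_real_derivative ?h' l) (at l)" for l
      unfolding Q_def by (rule DERIV_cong) algebra
  qed (use out T in \<open>auto intro!: continuous_intros continuous_on_cap\<close>)
  moreover have "integrable lborel (rad (\<lambda>l. exp (- ?N * l) * ?h' l) :: real^'n \<Rightarrow> real)"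
    by (rule integrable_continuous_compact_support[OF compact_annulus[of "c - T" "c + T"]])
      (use T in \<open>auto intro!: continuous_intros continuous_on_rad continuous_on_cap rad_outside[of "c - T" "c + T"] simp: out\<close>)
  moreover have "integrable lborel (rad (\<lambda>l. exp (- ?N * l) * ?P l ^ 4) :: real^'n \<Rightarrow> real)"
    by (rule integrable_continuous_compact_support[OF compact_annulus[of "c - T" "c + T"]])
      (auto intro!: continuous_intros continuous_on_rad continuous_on_cap rad_outside[of "c - T" "c + T"] simp: out)
  ultimately show ?thesis by simp
qed

subsection \<open>Moving the test functions to infinity\<close>

lemma sum_indicator_dyadic_shells:
  fixes a :: real and x :: "'a::real_normed_vector"
  assumes "a > 0"
  shows "(\<Sum>k<K. indicator (ball 0 (2 * (2 ^ k * a)) - ball 0 (2 ^ k * a)) x)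
    = (indicator (ball 0 (2 ^ K * a) - ball 0 a) x :: real)"
proof -
  have "indicator (ball 0 r' - ball 0 r) x = (indicator (ball 0 r') x - indicator (ball 0 r) x :: real)"
    if "r \<le> r'" for r r'
    using that by (auto simp: indicator_def)
  moreover have "2 ^ k * a \<le> 2 * (2 ^ k * a)" "a \<le> 2 ^ K * a" for k
    using assms by auto
  ultimately show ?thesis
    using sum_lessThan_telescope[of "\<lambda>k. indicator (ball 0 (2 ^ k * a)) x :: real" K]
    by (simp add: mult.assoc)
qed

lemma integrable_indicator_continuous:
  fixes V :: "'a::euclidean_space \<Rightarrow> real"
  assumes "continuous_on UNIV V" "bounded A" "A \<in> sets borel"
  shows "integrable lborel (\<lambda>x. indicator A x * V x)"
proof -
  obtain b where b: "A \<subseteq> cball 0 b" using assms(2) by (auto simp: bounded_iff subset_iff)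
  have "integrable lborel (\<lambda>x. indicator (cball 0 b) x * V x)"
    using borel_integrable_compact[of "cball 0 b" V] continuous_on_subset[OF assms(1)] by auto
  then show ?thesis
  proof (rule Bochner_Integration.integrable_bound)
    show "(\<lambda>x. indicator A x * V x) \<in> borel_measurable lborel"
      using assms borel_measurable_continuous_onI[OF assms(1)] by measurable
    show "AE x in lborel. norm (indicator A x * V x) \<le> norm (indicator (cball 0 b) x * V x)"
      using b by (intro AE_I2) (auto simp: indicator_def)
  qed
qed

definition shell_int :: "(real^'n \<Rightarrow> real) \<Rightarrow> real \<Rightarrow> real" where
  "shell_int V R = (LINT x|lborel. indicator (ball 0 (2 * R) - ball 0 R) x * V x)"

text \<open>The hypothesis on \<open>V\<close> concerns shells of ratio 2, whereas the test
  functions occupy annuli of ratio exp(2T). Finitely many dyadic shells cover such an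
  annulus.\<close>

lemma bound_by_shell_ints:
  fixes V F :: "real^'n \<Rightarrow> real"
  assumes V: "continuous_on UNIV V" "\<And>x. 0 \<le> V x" and F: "integrable lborel (\<lambda>x. V x * F x)"
    and a: "a > 0" and B: "\<And>x. F x \<le> B" "B \<ge> 0"
    and z: "\<And>x. norm x < a \<Longrightarrow> F x = 0" "\<And>x. norm x \<ge> 2 ^ K * a \<Longrightarrow> F x = 0"
  shows "(LINT x|lborel. V x * F x) \<le> B * (\<Sum>k<K. shell_int V (2 ^ k * a))"
proof -
  let ?S = "\<lambda>k. ball 0 (2 * (2 ^ k * a)) - ball 0 (2 ^ k * a) :: (real^'n) set"
  have I: "integrable lborel (\<lambda>x. indicator (?S k) x * V x)" for k
    by (rule integrable_indicator_continuous[OF V(1)]) (auto intro: bounded_diff)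
  have "(LINT x|lborel. V x * F x) \<le> (LINT x|lborel. B * (\<Sum>k<K. indicator (?S k) x * V x))"
  proof (rule integral_mono[OF F])
    show "integrable lborel (\<lambda>x. B * (\<Sum>k<K. indicator (?S k) x * V x))"
      by (intro integrable_mult_right Bochner_Integration.integrable_sum I)
    show "V x * F x \<le> B * (\<Sum>k<K. indicator (?S k) x * V x)" for x
    proof -
      have e: "(\<Sum>k<K. indicator (?S k) x * V x) = indicator (ball 0 (2 ^ K * a) - ball 0 a) x * V x"
        unfolding sum_distrib_right[symmetric] sum_indicator_dyadic_shells[OF a] ..
      show ?thesis unfolding e
      proof (cases "x \<in> ball 0 (2 ^ K * a) - ball 0 a")
        case True
        then show "V x * F x \<le> B * (indicator (ball 0 (2 ^ K * a) - ball 0 a) x * V x)"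
          using mult_right_mono[OF B(1) V(2)] by (simp add: mult.commute)
      next
        case False
        then show "V x * F x \<le> B * (indicator (ball 0 (2 ^ K * a) - ball 0 a) x * V x)"
          using z[of x] by auto
      qed
    qed
  qed
  also have "\<dots> = B * (\<Sum>k<K. shell_int V (2 ^ k * a))"
    unfolding shell_int_def using I by (subst integral_mult_right_zero, subst Bochner_Integration.integral_sum) auto
  finally show ?thesis .
qed

lemma measure_shell:
  assumes "R > 0"
  shows "measure lborel (ball 0 (2 * R) - ball (0::real^'n) R)
    = (2 ^ CARD('n) - 1) * R ^ CARD('n) * measure lborel (ball (0::real^'n) 1)"
proof -
  have "measure lborel (ball 0 (2 * R) - ball (0::real^'n) R)
    = measure lborel (ball (0::real^'n) (2 * R)) - measure lborel (ball (0::real^'n) R)"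
    using assms emeasure_bounded_finite[OF bounded_ball, of "0::real^'n" "2 * R"]
    by (intro measure_Diff) auto
  then show ?thesis
    using assms content_ball_conv_unit_ball[of "2 * R" "0::real^'n"] content_ball_conv_unit_ball[of R "0::real^'n"]
    by (simp add: algebra_simps power_mult_distrib)
qed

text \<open>The integral is invariant under scaling, so a bound independent of \<open>R\<close> must
  exist. The shell from R to 2R already gives one: there ln |x| differs from ln R by at most ln 2,
  which is less than \<open>T\<close>, and |x|^(-N) is at least (2R)^(-N).\<close>

lemma rad_mass_lower:
  assumes T: "T \<ge> 1" and R: "R > 0"
  shows "(2 ^ CARD('n) - 1) / 2 ^ CARD('n) * (T\<^sup>2 - (ln 2)\<^sup>2) ^ 4 * measure lborel (ball (0::real^'n) 1)
    \<le> (LINT x|lborel. rad (\<lambda>l. exp (- real CARD('n) * l) * cap T (l - ln R) ^ 4) (x::real^'n))"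
proof -
  let ?N = "CARD('n)"
  let ?S = "ball 0 (2 * R) - ball 0 R :: (real^'n) set"
  let ?F = "rad (\<lambda>l. exp (- real ?N * l) * cap T (l - ln R) ^ 4) :: real^'n \<Rightarrow> real"
  define p where "p = T\<^sup>2 - (ln 2 :: real)\<^sup>2"
  have l2: "0 < ln (2::real)" "ln (2::real) < 1" using ln_2_less_1 by auto
  have "(ln (2::real))\<^sup>2 \<le> 1" using l2 by (intro power_le_one) auto
  then have p0: "p \<ge> 0" using one_le_power[OF T, of 2] by (simp add: p_def)
  define b where "b = p ^ 4 / (2 * R) ^ ?N"
  have pw: "indicator ?S x * b \<le> ?F x" for x
  proof (cases "x \<in> ?S")
    case True
    then have x: "R \<le> norm x" "norm x < 2 * R" "x \<noteq> 0" using R by auto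
    then have n: "norm x > 0" by simp
    have "ln R \<le> ln (norm x)" "ln (norm x) \<le> ln (2 * R)" using x R n by auto
    then have "\<bar>ln (norm x) - ln R\<bar> \<le> ln 2" using R by (simp add: ln_mult)
    then have "(ln (norm x) - ln R)\<^sup>2 \<le> (ln 2)\<^sup>2" by (simp add: power2_le_iff_abs_le)
    then have c: "p \<le> cap T (ln (norm x) - ln R)" by (simp add: p_def cap_def)
    have "exp (- real ?N * ln (norm x)) = 1 / norm x ^ ?N"
      using n by (simp add: exp_minus exp_of_nat_mult inverse_eq_divide)
    also have "\<dots> \<ge> 1 / (2 * R) ^ ?N" using x n R by (intro divide_left_mono power_mono) auto
    finally have "1 / (2 * R) ^ ?N * p ^ 4 \<le> exp (- real ?N * ln (norm x)) * cap T (ln (norm x) - ln R) ^ 4"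
      using c p0 R by (intro mult_mono power_mono) auto
    then show ?thesis using True x by (simp add: rad_def b_def)
  qed (auto simp: rad_def cap_def)
  have IF: "integrable lborel ?F"
    by (rule integrable_continuous_compact_support[OF compact_annulus[of "ln R - T" "ln R + T"]])
      (use T in \<open>auto intro!: continuous_intros continuous_on_rad continuous_on_cap rad_outside[of "ln R - T" "ln R + T"] simp: cap_outside\<close>)
  have "(LINT x|lborel. indicator ?S x * b) \<le> (LINT x|lborel. ?F x)"
    by (rule integral_mono[OF _ IF pw])
      (intro integrable_mult_left integrable_real_indicator,
        use emeasure_bounded_finite[OF bounded_diff[OF bounded_ball], of "0::real^'n" "2 * R" "ball 0 R"] in auto)
  moreover have "(LINT x|lborel. indicator ?S x * b) = measure lborel ?S * b" by simp
  moreover have "measure lborel ?S * b = (2 ^ ?N - 1) / 2 ^ ?N * p ^ 4 * measure lborel (ball (0::real^'n) 1)"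
    unfolding measure_shell[OF R] b_def using R by (simp add: power_mult_distrib)
  ultimately show ?thesis by (simp add: p_def)
qed

text \<open>The test function is centred at ln R, with \<open>T\<close> fixed and \<open>R\<close>
  growing. On its support |x| is at least R exp(-T), so replacing |x| + \<rho> by |x| costs a factor
  tending to 1, while the \<open>V\<close> term tends to 0 and the Hardy mass stays above a positive
  constant.\<close>

lemma hardy_limit_scale:
  fixes V :: "real^'n \<Rightarrow> real"
  assumes N: "CARD('n) \<ge> 2" and s: "2 * s = real CARD('n) - 2" and T: "T \<ge> 1"
    and V: "continuous_on UNIV V" "\<And>x. 0 \<le> V x"
    and lim: "((\<lambda>R. shell_int V R / R ^ (CARD('n) - 2)) \<longlongrightarrow> 0) at_top"
    and C: "C \<ge> 0" "\<rho> > 0"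
    and test: "\<And>c. (LINT x|lborel. (C / (norm x + \<rho>)\<^sup>2 - V x) * rad (\<lambda>l. exp (- 2 * s * l) * cap T (l - c) ^ 4) x)
      \<le> (s\<^sup>2 + 3 / T\<^sup>2) * (LINT x|lborel. rad (\<lambda>l. exp (- real CARD('n) * l) * cap T (l - c) ^ 4) (x::real^'n))"
  shows "C \<le> s\<^sup>2 + 3 / T\<^sup>2"
proof -
  let ?N = "CARD('n)"
  let ?M = "?N - 2"
  have sM: "2 * s = real ?M" using s N by simp
  define \<kappa> where "\<kappa> = (2 ^ ?N - 1) / 2 ^ ?N * (T\<^sup>2 - (ln 2)\<^sup>2) ^ 4 * measure lborel (ball (0::real^'n) 1)"
  have "(ln (2::real))\<^sup>2 < 1" using ln_2_less_1 by (intro power_less_one_iff[THEN iffD2]) auto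
  then have "T\<^sup>2 - (ln 2)\<^sup>2 > 0" using T one_le_power[of T 2] by linarith
  moreover have "measure lborel (ball (0::real^'n) 1) > 0" by (simp add: content_ball_pos)
  moreover have "(2::real) ^ ?N - 1 > 0" using N by (simp add: one_less_power)
  ultimately have \<kappa>: "\<kappa> > 0" by (simp add: \<kappa>_def)
  \<comment> \<open>\<open>K\<close> doublings lead from R exp(-T) beyond R exp(T). This number does
    not depend on \<open>R\<close>, so the limit of the sum over shells is taken term by
    term.\<close>
  obtain K :: nat where K: "exp (2 * T) < 2 ^ K"
    using real_arch_pow[of 2 "exp (2 * T)"] by auto
  \<comment> \<open>T^8 bounds the fourth power of the cap. The factor \<open>2 ^ (k * ?M)\<close>
    converts the normalisation at the inner radius R exp(-T) into the one at the radius of the k-th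
    shell.\<close>
  define v where "v = (\<lambda>R. T ^ 8 * (\<Sum>k<K. 2 ^ (k * ?M) * (shell_int V (2 ^ k * (R * exp (- T))) / (2 ^ k * (R * exp (- T))) ^ ?M)))"
  have key: "C / (1 + \<rho> * exp T / R)\<^sup>2 \<le> s\<^sup>2 + 3 / T\<^sup>2 + v R / \<kappa>" if R: "R > 0" for R
  proof -
    define a where "a = R * exp (- T)"
    have a: "a > 0" using R by (simp add: a_def)
    let ?c = "ln R"
    have lna: "ln a = ?c - T" using R by (simp add: a_def ln_mult)
    let ?A = "annulus (?c - T) (?c + T) :: (real^'n) set"
    have expA: "exp (?c - T) = a" "exp (?c + T) = R * exp T" using R by (simp_all add: a_def exp_diff exp_add exp_minus field_simps)
    let ?F = "rad (\<lambda>l. exp (- 2 * s * l) * cap T (l - ?c) ^ 4) :: real^'n \<Rightarrow> real"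
    let ?E = "rad (\<lambda>l. exp (- real ?N * l) * cap T (l - ?c) ^ 4) :: real^'n \<Rightarrow> real"
    have z: "?F x = 0" "?E x = 0" if "x \<notin> ?A" for x
      using T that by (auto intro!: rad_outside[of "?c - T" "?c + T"] simp: cap_outside)
    have cF: "continuous_on ?A ?F" "continuous_on ?A ?E"
      by (intro continuous_intros continuous_on_rad continuous_on_cap)+
    have cV: "continuous_on ?A V" using V(1) by (rule continuous_on_subset) simp
    have cW: "continuous_on ?A (\<lambda>x. C / (norm x + \<rho>)\<^sup>2)"
      using C by (intro continuous_intros) (auto simp: add_nonneg_eq_0_iff)
    note int = integrable_continuous_compact_support[OF compact_annulus[of "?c - T" "?c + T"]]
    have I: "integrable lborel ?F" "integrable lborel ?E"
      "integrable lborel (\<lambda>x. V x * ?F x)" "integrable lborel (\<lambda>x. C / (norm x + \<rho>)\<^sup>2 * ?F x)"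
    proof -
      show "integrable lborel ?F" by (rule int[OF cF(1) z(1)])
      show "integrable lborel ?E" by (rule int[OF cF(2) z(2)])
      show "integrable lborel (\<lambda>x. V x * ?F x)"
        by (rule int[OF continuous_on_mult[OF cV cF(1)]]) (simp only: z mult_zero_right not_False_eq_True)
      show "integrable lborel (\<lambda>x. C / (norm x + \<rho>)\<^sup>2 * ?F x)"
        by (rule int[OF continuous_on_mult[OF cW cF(1)]]) (simp only: z mult_zero_right not_False_eq_True)
    qed
    have EF: "?E x = ?F x / (norm x)\<^sup>2" for x
    proof -
      have "exp (- real ?N * l) = exp (- 2 * s * l) / (exp l)\<^sup>2" for l
      proof -
        have "- real ?N * l = - 2 * s * l - 2 * l" using s by algebra
        then show ?thesis by (simp only: exp_diff exp_double)
      qed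
      then show ?thesis by (cases "x = 0") (simp_all add: rad_def)
    qed
    have F0: "?F x \<ge> 0" for x by (simp add: rad_def cap_def)
    have Fb: "?F x \<le> T ^ 8 / a ^ ?M" for x
    proof (cases "x \<in> ?A")
      case True
      then have nx: "norm x \<ge> a" "norm x > 0" "x \<noteq> 0" using a by (auto simp: annulus_def expA)
      have "exp (- 2 * s * ln (norm x)) = 1 / norm x ^ ?M"
      proof -
        have "exp (- 2 * s * ln (norm x)) = exp (- (real ?M * ln (norm x)))" using sM by simp
        then show ?thesis using nx by (simp add: exp_minus exp_of_nat_mult inverse_eq_divide)
      qed
      also have "\<dots> \<le> 1 / a ^ ?M" using nx a by (intro divide_left_mono power_mono) auto
      finally have 1: "exp (- 2 * s * ln (norm x)) \<le> 1 / a ^ ?M" .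
      have "cap T (ln (norm x) - ?c) \<le> T\<^sup>2" by (simp add: cap_def)
      then have "cap T (ln (norm x) - ?c) ^ 4 \<le> (T\<^sup>2) ^ 4" by (intro power_mono) (auto simp: cap_def)
      also have "\<dots> = T ^ 8" by (simp flip: power_mult)
      finally show ?thesis using mult_mono[OF 1, of "cap T (ln (norm x) - ?c) ^ 4" "T ^ 8"] nx a
        by (simp add: rad_def)
    next
      case False
      then show ?thesis using z a T by simp
    qed
    have VF: "(LINT x|lborel. V x * ?F x) \<le> v R"
    proof -
      have "(LINT x|lborel. V x * ?F x) \<le> T ^ 8 / a ^ ?M * (\<Sum>k<K. shell_int V (2 ^ k * a))"
      proof (rule bound_by_shell_ints[OF V I(3) a Fb])
        show "?F x = 0" if "norm x < a" for x using that by (intro z) (auto simp: annulus_def expA)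
        have "exp T * exp T < 2 ^ K" using K by (simp flip: exp_add)
        then have "R * exp T < 2 ^ K * a" using R by (simp add: a_def exp_minus field_simps)
        then show "?F x = 0" if "2 ^ K * a \<le> norm x" for x using that by (intro z) (auto simp: annulus_def expA)
      qed (use a T in auto)
      also have "\<dots> = v R"
        unfolding v_def a_def[symmetric] using a
        by (simp add: sum_distrib_left power_mult_distrib power_mult[symmetric])
      finally show ?thesis .
    qed
    have v0: "v R \<ge> 0"
    proof -
      have "0 \<le> (LINT x|lborel. V x * ?F x)" using V(2) F0 by (intro integral_nonneg_AE) auto
      with VF show ?thesis by simp
    qed
    define q where "q = C / (1 + \<rho> * exp T / R)\<^sup>2"
    have WF: "q * ?E x \<le> C / (norm x + \<rho>)\<^sup>2 * ?F x" for x
    proof (cases "x \<in> ?A")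
      case True
      then have nx: "norm x \<ge> a" "norm x > 0" using a by (auto simp: annulus_def expA)
      have "\<rho> \<le> norm x * (\<rho> * exp T / R)"
        using nx(1) C R mult_right_mono[of a "norm x" "\<rho> * exp T / R"] by (simp add: a_def exp_minus field_simps)
      then have "norm x + \<rho> \<le> norm x * (1 + \<rho> * exp T / R)" by (simp add: algebra_simps)
      then have "(norm x + \<rho>)\<^sup>2 \<le> (norm x * (1 + \<rho> * exp T / R))\<^sup>2" using C nx by (intro power_mono) auto
      then have "C / (norm x * (1 + \<rho> * exp T / R))\<^sup>2 \<le> C / (norm x + \<rho>)\<^sup>2"
        using C nx R by (intro divide_left_mono mult_pos_pos zero_less_power add_pos_nonneg) auto
      then have "C / (norm x * (1 + \<rho> * exp T / R))\<^sup>2 * ?F x \<le> C / (norm x + \<rho>)\<^sup>2 * ?F x"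
        using F0 by (intro mult_right_mono)
      then show ?thesis unfolding EF by (simp add: q_def power_mult_distrib mult.commute)
    qed (simp only: z mult_zero_right not_False_eq_True order_refl)
    let ?k = "LINT x|lborel. ?E x"
    have k: "\<kappa> \<le> ?k" unfolding \<kappa>_def by (rule rad_mass_lower[OF T R])
    have "q * ?k = (LINT x|lborel. q * ?E x)" by simp
    also have "\<dots> \<le> (LINT x|lborel. C / (norm x + \<rho>)\<^sup>2 * ?F x)"
      by (intro integral_mono WF I integrable_mult_right)
    also have "\<dots> = (LINT x|lborel. (C / (norm x + \<rho>)\<^sup>2 - V x) * ?F x) + (LINT x|lborel. V x * ?F x)"
      using I by (subst Bochner_Integration.integral_add[symmetric]) (auto simp: left_diff_distrib)
    also have "\<dots> \<le> (s\<^sup>2 + 3 / T\<^sup>2) * ?k + v R" by (intro add_mono test VF)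
    \<comment> \<open>The additive error becomes a multiple of the Hardy mass \<open>?k\<close>, so
      that \<open>?k\<close>, whose exact value is unknown, can be cancelled.\<close>
    also have "v R \<le> v R / \<kappa> * ?k" using k \<kappa> v0 mult_left_mono[OF k, of "v R / \<kappa>"] by simp
    finally have "q * ?k \<le> (s\<^sup>2 + 3 / T\<^sup>2 + v R / \<kappa>) * ?k" by (simp add: algebra_simps)
    then have "q \<le> s\<^sup>2 + 3 / T\<^sup>2 + v R / \<kappa>"
      by (rule mult_right_le_imp_le) (use k \<kappa> in linarith)
    then show ?thesis by (simp only: q_def)
  qed
  have "(v \<longlongrightarrow> 0) at_top"
  proof -
    have "((\<lambda>R. 2 ^ (k * ?M) * (shell_int V (2 ^ k * (R * exp (- T))) / (2 ^ k * (R * exp (- T))) ^ ?M)) \<longlongrightarrow> 2 ^ (k * ?M) * 0) at_top" for k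
    proof (intro tendsto_mult tendsto_const filterlim_compose[OF lim])
      have "filterlim (\<lambda>R. (2 ^ k * exp (- T)) * R) at_top at_top"
        by (intro filterlim_tendsto_pos_mult_at_top[OF tendsto_const] filterlim_ident) auto
      then show "filterlim (\<lambda>R. 2 ^ k * (R * exp (- T))) at_top at_top"
        by (simp add: mult_ac)
    qed
    then have "(v \<longlongrightarrow> T ^ 8 * (\<Sum>k<K. 2 ^ (k * ?M) * 0)) at_top"
      unfolding v_def by (rule tendsto_mult[OF tendsto_const tendsto_sum])
    then show ?thesis by simp
  qed
  then have "((\<lambda>R. s\<^sup>2 + 3 / T\<^sup>2 + v R / \<kappa>) \<longlongrightarrow> s\<^sup>2 + 3 / T\<^sup>2 + 0 / \<kappa>) at_top"
    using \<kappa> by (intro tendsto_intros) auto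
  moreover have "((\<lambda>R. C / (1 + \<rho> * exp T / R)\<^sup>2) \<longlongrightarrow> C) at_top"
  proof -
    have "((\<lambda>R. \<rho> * exp T / R) \<longlongrightarrow> 0) at_top"
      by (rule real_tendsto_divide_at_top[OF tendsto_const filterlim_ident])
    then have "((\<lambda>R. C / (1 + \<rho> * exp T / R)\<^sup>2) \<longlongrightarrow> C / (1 + 0)\<^sup>2) at_top"
      by (intro tendsto_intros) auto
    then show ?thesis by simp
  qed
  moreover have "\<forall>\<^sub>F R in at_top. C / (1 + \<rho> * exp T / R)\<^sup>2 \<le> s\<^sup>2 + 3 / T\<^sup>2 + v R / \<kappa>"
    using eventually_gt_at_top[of 0] by eventually_elim (rule key)
  ultimately have "C \<le> s\<^sup>2 + 3 / T\<^sup>2 + 0 / \<kappa>"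
    by (rule tendsto_le[OF trivial_limit_at_top_linorder])
  then show ?thesis by simp
qed

text \<open>For a fixed test function the loss is \<eta> times its integral, which vanishes with
  \<eta>. That integral grows like R^2 as the function moves outwards, so this limit precedes the
  scale limit; T to infinity then removes the cost of the cutoff.\<close>

lemma hardy_limit:
  fixes V :: "real^'n \<Rightarrow> real"
  assumes N: "CARD('n) \<ge> 2" and s: "2 * s = real CARD('n) - 2"
    and V: "continuous_on UNIV V" "\<And>x. 0 \<le> V x"
    and lim: "((\<lambda>R. shell_int V R / R ^ (CARD('n) - 2)) \<longlongrightarrow> 0) at_top"
    and C: "C \<ge> 0" "\<rho> > 0"
    and S: "\<And>K \<eta>. compact K \<Longrightarrow> \<eta> > 0 \<Longrightarrow> positive_supersol K (\<lambda>x. C / (norm x + \<rho>)\<^sup>2 - V x - \<eta>)"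
  shows "C \<le> s\<^sup>2"
proof -
  have W: "continuous_on UNIV (\<lambda>x::real^'n. C / (norm x + \<rho>)\<^sup>2 - V x)"
    using C by (intro continuous_intros V) (auto simp: add_nonneg_eq_0_iff)
  have *: "C \<le> s\<^sup>2 + 3 / T\<^sup>2" if T: "T \<ge> 1" for T
  proof (rule hardy_limit_scale[OF N s T V lim C])
    fix c
    let ?A = "annulus (c - T) (c + T) :: (real^'n) set"
    let ?F = "rad (\<lambda>l. exp (- 2 * s * l) * cap T (l - c) ^ 4) :: real^'n \<Rightarrow> real"
    let ?Q = "\<lambda>x. C / (norm x + \<rho>)\<^sup>2 - V x"
    let ?b = "(s\<^sup>2 + 3 / T\<^sup>2) * (LINT x|lborel. rad (\<lambda>l. exp (- real CARD('n) * l) * cap T (l - c) ^ 4) (x::real^'n))"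
    have z: "?F x = 0" if "x \<notin> ?A" for x
      using T that by (auto intro!: rad_outside[of "c - T" "c + T"] simp: cap_outside)
    have cF: "continuous_on ?A ?F"
      by (intro continuous_intros continuous_on_rad continuous_on_cap)
    note int = integrable_continuous_compact_support[OF compact_annulus[of "c - T" "c + T"]]
    have I: "integrable lborel ?F" "integrable lborel (\<lambda>x. ?Q x * ?F x)"
    proof -
      show "integrable lborel ?F" by (rule int[OF cF z])
      show "integrable lborel (\<lambda>x. ?Q x * ?F x)"
        by (rule int[OF continuous_on_mult[OF continuous_on_subset[OF W subset_UNIV] cF]])
          (simp only: z mult_zero_right not_False_eq_True)
    qed
    have "(LINT x|lborel. ?Q x * ?F x) \<le> ?b + \<eta> * (LINT x|lborel. ?F x)" if "\<eta> > 0" for \<eta>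
    proof -
      have "(LINT x|lborel. (?Q x - \<eta>) * ?F x) \<le> ?b"
        using T by (intro hardy_test s S compact_annulus that continuous_intros W) auto
      moreover have "(LINT x|lborel. (?Q x - \<eta>) * ?F x) = (LINT x|lborel. ?Q x * ?F x) - \<eta> * (LINT x|lborel. ?F x)"
        using I by (simp only: left_diff_distrib[of _ \<eta>]) simp
      ultimately show ?thesis by simp
    qed
    moreover have "((\<lambda>\<eta>. ?b + \<eta> * (LINT x|lborel. ?F x)) \<longlongrightarrow> ?b + 0 * (LINT x|lborel. ?F x)) (at_right 0)"
      by (intro tendsto_intros)
    ultimately show "(LINT x|lborel. ?Q x * ?F x) \<le> ?b"
      by (intro tendsto_lowerbound[where F = "at_right 0" and f = "\<lambda>\<eta>. ?b + \<eta> * (LINT x|lborel. ?F x)"])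
        (auto simp: eventually_at_filter)
  qed
  have "((\<lambda>T::real. s\<^sup>2 + 3 / T\<^sup>2) \<longlongrightarrow> s\<^sup>2 + 0) at_top"
    by (intro tendsto_add tendsto_const real_tendsto_divide_at_top filterlim_pow_at_top filterlim_ident) auto
  moreover have "\<forall>\<^sub>F T in at_top. C \<le> s\<^sup>2 + 3 / T\<^sup>2"
    using eventually_ge_at_top[of 1] by eventually_elim (rule *)
  ultimately show ?thesis by (intro tendsto_lowerbound[of "\<lambda>T. s\<^sup>2 + 3 / T\<^sup>2" _ at_top]) auto
qed

subsection \<open>Mollified weak solutions\<close>

lemma L1_loc_vec_nth:
  fixes G :: "real^'n \<Rightarrow> real^'m"
  assumes "G \<in> L1_loc" shows "(\<lambda>x. G x $ i) \<in> L1_loc"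
  unfolding L1_loc_def
proof safe
  fix K :: "(real^'n) set" assume "compact K"
  then have "integrable lebesgue (\<lambda>x. indicator K x *\<^sub>R G x)"
    using assms unfolding L1_loc_def set_integrable_def by blast
  from integrable_bounded_linear[OF bounded_linear_vec_nth this, of i]
  show "(\<lambda>x. G x $ i) absolutely_integrable_on K" by (simp add: set_integrable_def)
qed

lemma integral_vec_nth_scaleR_test:
  fixes u :: "real^'n \<Rightarrow> real"
  assumes "u \<in> L1_loc" "\<psi> \<in> test_fun"
  shows "(LINT y|lebesgue. u y *\<^sub>R grad \<psi> y) $ i = (LINT y|lebesgue. u y * grad \<psi> y $ i)"
proof -
  have I: "integrable lebesgue (\<lambda>y. u y * grad \<psi> y $ j)" for j
    using L1_loc_test_integrable[OF assms(1) test_fun_deriv[OF assms(2)]] by (simp add: grad_def)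
  have "(\<lambda>y. u y *\<^sub>R grad \<psi> y) = (\<lambda>y. \<Sum>j\<in>UNIV. (u y * grad \<psi> y $ j) *\<^sub>R axis j 1)"
    by (simp add: fun_eq_iff vec_eq_iff axis_def if_distrib cong: if_cong)
  then have "integrable lebesgue (\<lambda>y. u y *\<^sub>R grad \<psi> y)"
    using I by simp
  from integral_bounded_linear[OF bounded_linear_vec_nth this, of i] show ?thesis by simp
qed

lemma weak_grad_test:
  fixes u :: "real^'n \<Rightarrow> real"
  assumes "has_weak_grad u G" "\<psi> \<in> test_fun"
  shows "(LINT y|lebesgue. u y * grad \<psi> y $ i) = - (LINT y|lebesgue. G y $ i * \<psi> y)"
proof -
  have G: "u \<in> L1_loc" "G \<in> L1_loc"
    "(LINT x|lebesgue. u x *\<^sub>R grad \<psi> x) = - (LINT x|lebesgue. \<psi> x *\<^sub>R G x)"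
    using assms by (auto simp: has_weak_grad_def)
  have I: "integrable lebesgue (\<lambda>y. G y $ j * \<psi> y)" for j
    by (rule L1_loc_test_integrable[OF L1_loc_vec_nth[OF G(2)] assms(2)])
  have "(\<lambda>y. \<psi> y *\<^sub>R G y) = (\<lambda>y. \<Sum>j\<in>UNIV. (G y $ j * \<psi> y) *\<^sub>R axis j 1)"
    by (simp add: fun_eq_iff vec_eq_iff axis_def if_distrib mult.commute cong: if_cong)
  then have "integrable lebesgue (\<lambda>y. \<psi> y *\<^sub>R G y)"
    using I by simp
  from integral_bounded_linear[OF bounded_linear_vec_nth this, of i]
  have "(LINT y|lebesgue. \<psi> y *\<^sub>R G y) $ i = (LINT y|lebesgue. G y $ i * \<psi> y)" by (simp add: mult.commute)
  then show ?thesis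
    using G(3) integral_vec_nth_scaleR_test[OF G(1) assms(2), of i] by simp
qed

text \<open>Positivity almost everywhere becomes positivity at every point, as required for a
  function that is divided by. A zero of the convolution would force the kernel to vanish almost
  everywhere on a ball where it is positive.\<close>

lemma conv_pos:
  fixes u :: "real^'n \<Rightarrow> real"
  assumes u: "u \<in> L1_loc" "AE x in lebesgue. u x > 0"
    and k: "k \<in> test_fun" "\<And>z. k z \<ge> 0" "\<And>z. k z > 0 \<longleftrightarrow> norm z < r" and r: "r > 0"
  shows "conv u k x > 0"
proof -
  have nn: "AE y in lebesgue. 0 \<le> u y * k (x - y)" using u(2) by eventually_elim (use k(2) in simp)
  have "conv u k x \<noteq> 0"
  proof
    assume "conv u k x = 0"
    then have "AE y in lebesgue. u y * k (x - y) = 0"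
      unfolding conv_def using integral_nonneg_eq_0_iff_AE[OF conv_integrable[OF u(1) k(1)] nn] by simp
    with u(2) have "AE y in lebesgue. y \<notin> ball x r"
    proof eventually_elim
      case (elim y)
      then have "k (x - y) = 0" by simp
      then show ?case using k(3)[of "x - y"] by (simp add: dist_norm)
    qed
    then have "emeasure lebesgue (ball x r) = 0"
      by (subst (asm) AE_iff_measurable[where N="ball x r"]) auto
    then have "measure lebesgue (ball x r) = 0" by (simp add: measure_def)
    with content_ball_pos[OF r, of x] show False by simp
  qed
  moreover have "conv u k x \<ge> 0" unfolding conv_def using nn by (rule integral_nonneg_AE)
  ultimately show ?thesis by simp
qed

lemma uniform_lower_bound:
  fixes Q :: "real^'n \<Rightarrow> real"
  assumes "compact K" "continuous_on UNIV Q" "\<eta> > 0"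
  obtains r where "r > 0" "\<And>x y. x \<in> K \<Longrightarrow> norm (x - y) < r \<Longrightarrow> Q x - \<eta> \<le> Q y"
proof -
  obtain b where b: "\<And>x. x \<in> K \<Longrightarrow> norm x \<le> b"
    using compact_imp_bounded[OF assms(1)] by (auto simp: bounded_pos)
  \<comment> \<open>The point \<open>y\<close> may leave \<open>K\<close>, though by less than 1, so
    uniform continuity is taken on a larger ball.\<close>
  have "uniformly_continuous_on (cball 0 (b + 1)) Q"
    by (intro compact_uniformly_continuous continuous_on_subset[OF assms(2)]) auto
  then obtain d where d: "d > 0"
    "\<And>x y. x \<in> cball 0 (b + 1) \<Longrightarrow> y \<in> cball 0 (b + 1) \<Longrightarrow> dist y x < d \<Longrightarrow> dist (Q y) (Q x) < \<eta>"
    using \<open>\<eta> > 0\<close> unfolding uniformly_continuous_on_def by metis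
  show ?thesis
  proof (rule that[of "min d 1"])
    fix x y assume xy: "x \<in> K" "norm (x - y) < min d 1"
    then have "norm y \<le> b + 1" using b[of x] norm_triangle_ineq2[of y x] by (simp add: norm_minus_commute)
    then have "dist (Q y) (Q x) < \<eta>"
      using b[of x] xy by (intro d) (auto simp: dist_norm norm_minus_commute)
    then show "Q x - \<eta> \<le> Q y" by (simp add: dist_real_def)
  qed (use d in auto)
qed

section \<open>Measurability and lower bound of the Riesz convolution\<close>

lemma borel_measurable_riesz_conv:
  fixes u :: "real^'n \<Rightarrow> real"
  assumes "u \<in> borel_measurable lebesgue"
  shows "riesz_conv (\<lambda>y. \<bar>u y\<bar>\<^sup>2) \<in> borel_measurable lebesgue"
proof -
  \<comment> \<open>A parameter integral is measurable when its integrand is jointly Borel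
    measurable. A Lebesgue measurable \<open>u\<close> does not provide this, so it is exchanged for
    a Borel representative, which leaves the convolution unchanged at every point.\<close>
  obtain v where v: "v \<in> borel_measurable lborel" "AE y in lborel. u y = v y"
    using completion_ex_borel_measurable_real[OF assms] by blast
  have [measurable]: "riesz \<in> borel_measurable (borel :: (real^'n) measure)"
    unfolding riesz_def by measurable
  have [measurable]: "v \<in> borel_measurable borel" using v(1) by simp
  have "AE y in lebesgue. u y = v y" using v(2) by (rule AE_completion)
  then have "riesz_conv (\<lambda>y. \<bar>u y\<bar>\<^sup>2) x = (\<integral>\<^sup>+ y. ennreal (riesz (x - y) * \<bar>v y\<bar>\<^sup>2) \<partial>lebesgue)" for x
    unfolding riesz_conv_def by (intro nn_integral_cong_AE) (auto elim: eventually_mono)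
  also have "\<dots> x = (\<integral>\<^sup>+ y. ennreal (riesz (x - y) * \<bar>v y\<bar>\<^sup>2) \<partial>lborel)" for x
    by (rule nn_integral_completion)
  finally have "riesz_conv (\<lambda>y. \<bar>u y\<bar>\<^sup>2) = (\<lambda>x. \<integral>\<^sup>+ y. ennreal (riesz (x - y) * \<bar>v y\<bar>\<^sup>2) \<partial>lborel)" by auto
  moreover have "(\<lambda>x. \<integral>\<^sup>+ y. ennreal (riesz (x - y) * \<bar>v y\<bar>\<^sup>2) \<partial>lborel) \<in> borel_measurable borel"
    by measurable
  ultimately show ?thesis by (simp add: measurable_completion)
qed

definition riesz_const :: "'n::finite itself \<Rightarrow> real" where
  "riesz_const _ = Gamma ((real CARD('n) - 2) / 2) * pi powr (real CARD('n) / 2) * 2 ^ (CARD('n) - 2)"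

lemma riesz_const_pos: "CARD('n::finite) \<ge> 3 \<Longrightarrow> riesz_const TYPE('n) > 0"
  unfolding riesz_const_def by (intro mult_pos_pos Gamma_real_pos) auto

lemma riesz_conv_lower:
  fixes u :: "real^'n \<Rightarrow> real"
  assumes N: "CARD('n) \<ge> 3" and \<rho>: "\<rho> > 0" and u: "u \<in> borel_measurable lebesgue"
    and I: "integrable lebesgue (\<lambda>y. indicator (ball 0 \<rho>) y * (u y)\<^sup>2)"
  shows "ennreal ((LINT y|lebesgue. indicator (ball 0 \<rho>) y * (u y)\<^sup>2) / riesz_const TYPE('n) / (norm x + \<rho>)\<^sup>2)
    \<le> riesz_conv (\<lambda>y. \<bar>u y\<bar>\<^sup>2) x"
proof -
  let ?A = "riesz_const TYPE('n)"
  let ?d = "1 / (?A * (norm x + \<rho>)\<^sup>2)"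
  have A: "?A > 0" by (rule riesz_const_pos[OF N])
  have riesz: "riesz z = 1 / (?A * (norm z)\<^sup>2)" for z :: "real^'n"
    by (simp add: riesz_def riesz_const_def)
  have "ennreal (?d * (LINT y|lebesgue. indicator (ball 0 \<rho>) y * (u y)\<^sup>2))
      = ennreal (LINT y|lebesgue. ?d * (indicator (ball 0 \<rho>) y * (u y)\<^sup>2))" by simp
  also have "\<dots> = (\<integral>\<^sup>+ y. ennreal (?d * (indicator (ball 0 \<rho>) y * (u y)\<^sup>2)) \<partial>lebesgue)"
    using A \<rho> by (intro nn_integral_eq_integral[symmetric] integrable_mult_right I AE_I2 mult_nonneg_nonneg) auto
  also have "\<dots> \<le> riesz_conv (\<lambda>y. \<bar>u y\<bar>\<^sup>2) x"
    unfolding riesz_conv_def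
  proof (rule nn_integral_mono_AE)
    \<comment> \<open>At \<open>y = x\<close> the kernel has the conventional value 0 and the lower
      bound could fail.\<close>
    have "AE y in lebesgue. y \<noteq> x"
      by (intro AE_completion AE_lborel_singleton)
    then show "AE y in lebesgue. ennreal (?d * (indicator (ball 0 \<rho>) y * (u y)\<^sup>2)) \<le> ennreal (riesz (x - y) * \<bar>u y\<bar>\<^sup>2)"
    proof eventually_elim
      case (elim y)
      have "?d * (indicator (ball 0 \<rho>) y * (u y)\<^sup>2) \<le> riesz (x - y) * (u y)\<^sup>2"
      proof (cases "norm y < \<rho>")
        case True
        have "norm (x - y) \<le> norm x + \<rho>" using norm_triangle_ineq4[of x y] True by simp
        then have "?d \<le> riesz (x - y)"
          unfolding riesz using A elim by (intro divide_left_mono mult_left_mono power_mono mult_pos_pos) auto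
        then show ?thesis using True mult_right_mono[of ?d "riesz (x - y)" "(u y)\<^sup>2"] by simp
      qed (use A in \<open>simp add: riesz\<close>)
      then show ?case by (simp add: ennreal_leI)
    qed
  qed
  finally show ?thesis by (simp add: field_simps)
qed

text \<open>The witness is \<open>conv u \<zeta>\<close>. Testing the equation with the reflected
  kernel centred at \<open>x\<close> expresses its Laplacian at \<open>x\<close> by averages over
  the ball of radius \<open>r\<close>. There the continuous \<open>Q\<close> is at least
  \<open>Q x - \<eta>\<close>, and \<open>u\<close> and the kernel are nonnegative, so
  \<open>Q\<close> can be pulled out of the average. The minorant \<open>w\<close> stands in for the
  convolution because such a comparison of values requires continuity.\<close>

lemma weak_solution_positive_supersol:
  fixes V u :: "real^'n \<Rightarrow> real"
  assumes e: "\<epsilon> > 0" and V: "continuous_on UNIV V" and u: "u \<in> H1_loc" "AE x in lebesgue. u x > 0"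
    and sol: "weak_solution \<epsilon> V u"
    and w: "continuous_on UNIV w" "\<And>x. 0 \<le> w x" "\<And>x. ennreal (w x) \<le> riesz_conv (\<lambda>y. \<bar>u y\<bar>\<^sup>2) x"
    and K: "compact K" and \<eta>: "\<eta> > 0"
  shows "positive_supersol K (\<lambda>x. w x / \<epsilon> ^ (CARD('n) - 2) / \<epsilon>\<^sup>2 - V x / \<epsilon>\<^sup>2 - \<eta>)"
proof -
  let ?G = "weak_grad u"
  let ?W = "riesz_conv (\<lambda>y. \<bar>u y\<bar>\<^sup>2)"
  let ?M = "CARD('n) - 2"
  have G: "has_weak_grad u ?G" using u(1) someI_ex[of "has_weak_grad u"] by (auto simp: H1_loc_def weak_grad_def)
  then have L1: "u \<in> L1_loc" "?G \<in> L1_loc" by (auto simp: has_weak_grad_def)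
  have um: "u \<in> borel_measurable lebesgue" using u(1) by (auto simp: H1_loc_def L2_loc_def)
  have Wm: "?W \<in> borel_measurable lebesgue" by (rule borel_measurable_riesz_conv[OF um])
  have fin: "(\<integral>\<^sup>+ x\<in>K. ?W x * ennreal \<bar>u x\<bar> \<partial>lebesgue) < \<infinity>" if "compact K" for K
    using sol that unfolding weak_solution_def by blast
  have eq: "(LINT x|lebesgue. \<epsilon>\<^sup>2 * (?G x \<bullet> grad \<phi> x) + V x * u x * \<phi> x)
        = (1 / \<epsilon> ^ ?M) * (LINT x|lebesgue. enn2real (?W x) * u x * \<phi> x)" if "\<phi> \<in> test_fun" for \<phi>
    using sol that unfolding weak_solution_def by blast
  have WL1: "(\<lambda>x. enn2real (?W x) * u x) \<in> L1_loc"
    unfolding L1_loc_def set_integrable_def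
  proof safe
    fix K :: "(real^'n) set" assume K: "compact K"
    have Km: "K \<in> sets lebesgue" using K by (simp add: lmeasurable_compact fmeasurableD)
    show "integrable lebesgue (\<lambda>x. indicator K x *\<^sub>R (enn2real (?W x) * u x))"
    proof (rule integrableI_bounded)
      show "(\<lambda>x. indicator K x *\<^sub>R (enn2real (?W x) * u x)) \<in> borel_measurable lebesgue"
        using Km Wm um by measurable
      have "ennreal (norm (indicator K x *\<^sub>R (enn2real (?W x) * u x))) \<le> ?W x * ennreal \<bar>u x\<bar> * indicator K x" for x
      proof -
        have "ennreal (enn2real (?W x)) \<le> ?W x"
          by (cases "?W x") auto
        then show ?thesis
          by (auto simp: indicator_def abs_mult ennreal_mult intro!: mult_right_mono)
      qed
      then have "(\<integral>\<^sup>+ x. ennreal (norm (indicator K x *\<^sub>R (enn2real (?W x) * u x))) \<partial>lebesgue)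
        \<le> (\<integral>\<^sup>+ x\<in>K. ?W x * ennreal \<bar>u x\<bar> \<partial>lebesgue)"
        by (intro nn_integral_mono)
      with fin[OF K] show "(\<integral>\<^sup>+ x. ennreal (norm (indicator K x *\<^sub>R (enn2real (?W x) * u x))) \<partial>lebesgue) < \<infinity>"
        by (rule le_less_trans[rotated])
    qed
  qed
  \<comment> \<open>Local integrability controls only the product with \<open>u\<close>; positivity
    of \<open>u\<close> passes finiteness on to the convolution. Without it \<open>enn2real\<close>
    could replace an infinite value by 0, and the comparison with \<open>w\<close> would
    fail.\<close>
  have Wfin: "AE x in lebesgue. ?W x < \<infinity>"
  proof -
    have "AE x in lebesgue. \<forall>n::nat. x \<in> cball 0 (real n) \<longrightarrow> ?W x < \<infinity>"
    proof (rule AE_all_countable[THEN iffD2], rule allI)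
      fix n :: nat
      have "AE x in lebesgue. ?W x * ennreal \<bar>u x\<bar> * indicator (cball 0 (real n)) x \<noteq> \<infinity>"
        using fin[of "cball 0 (real n)"] 
        by (intro nn_integral_PInf_AE borel_measurable_times_ennreal borel_measurable_indicator
            measurable_compose[OF _ measurable_ennreal] borel_measurable_abs Wm um) auto
      with u(2) show "AE x in lebesgue. x \<in> cball 0 (real n) \<longrightarrow> ?W x < \<infinity>"
        by eventually_elim (auto simp: less_top ennreal_mult_eq_top_iff)
    qed
    then show ?thesis
    proof eventually_elim
      case (elim x)
      obtain n :: nat where "norm x \<le> real n" using real_arch_simple by blast
      with elim show ?case by auto
    qed
  qed
  have wW: "AE x in lebesgue. w x \<le> enn2real (?W x)"
    using Wfin
  proof eventually_elim
    case (elim x)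
    with w(2,3)[of x] show ?case by (metis enn2real_ennreal enn2real_mono infinity_ennreal_def)
  qed
  define Q where "Q = (\<lambda>x. w x / \<epsilon> ^ ?M / \<epsilon>\<^sup>2 - V x / \<epsilon>\<^sup>2)"
  have cQ: "continuous_on UNIV Q" unfolding Q_def using e by (intro continuous_intros w(1) V) auto
  obtain r where r: "r > 0" "\<And>x y. x \<in> K \<Longrightarrow> norm (x - y) < r \<Longrightarrow> Q x - \<eta> \<le> Q y"
    using uniform_lower_bound[OF K cQ \<eta>] by blast
  obtain \<zeta> :: "real^'n \<Rightarrow> real" where \<zeta>: "\<zeta> \<in> test_fun" "\<And>z. \<zeta> z \<ge> 0" "\<And>z. \<zeta> z > 0 \<longleftrightarrow> norm z < r"
    using bump_exists[OF r(1)] by blast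
  define d\<zeta> where "d\<zeta> = (\<lambda>(i::'n) z. frechet_derivative \<zeta> (at z) (axis i 1))"
  define dd\<zeta> where "dd\<zeta> = (\<lambda>(i::'n) z. frechet_derivative (d\<zeta> i) (at z) (axis i 1))"
  have d\<zeta>: "d\<zeta> i \<in> test_fun" for i unfolding d\<zeta>_def by (rule test_fun_deriv[OF \<zeta>(1)])
  have dd\<zeta>: "dd\<zeta> i \<in> test_fun" for i unfolding dd\<zeta>_def by (rule test_fun_deriv[OF d\<zeta>])
  \<comment> \<open>One of the two derivatives moves from the kernel to \<open>u\<close>. The sign
    from the reflection cancels the one in the definition of the weak gradient.\<close>
  have laplace: "conv u (dd\<zeta> i) x = (LINT y|lebesgue. ?G y $ i * d\<zeta> i (x - y))" for i x
    using weak_grad_test[OF G test_fun_reflect[OF d\<zeta>], of i x i]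
    unfolding grad_reflect[OF d\<zeta>] by (simp add: conv_def dd\<zeta>_def)
  have ineq: "(Q x - \<eta>) * conv u \<zeta> x \<le> - (\<Sum>i\<in>UNIV. conv u (dd\<zeta> i) x)" if x: "x \<in> K" for x
  proof -
    note \<psi> = test_fun_reflect[OF \<zeta>(1), of x]
    have gr: "?G y \<bullet> grad (\<lambda>y. \<zeta> (x - y)) y = - (\<Sum>i\<in>UNIV. ?G y $ i * d\<zeta> i (x - y))" for y
      unfolding grad_reflect[OF \<zeta>(1)] inner_vec_def by (simp add: d\<zeta>_def sum_negf)
    have I1: "integrable lebesgue (\<lambda>y. ?G y $ i * d\<zeta> i (x - y))" for i
      by (rule L1_loc_test_integrable[OF L1_loc_vec_nth[OF L1(2)] test_fun_reflect[OF d\<zeta>]])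
    obtain M where M: "\<And>y. \<bar>V y * \<zeta> (x - y)\<bar> \<le> M" "\<And>y. \<bar>w y * \<zeta> (x - y)\<bar> \<le> M" 
        and b: "\<exists>b. \<forall>y. b < norm y \<longrightarrow> \<zeta> (x - y) = 0"
    proof -
      obtain b where b: "b > 0" "\<And>y. b \<le> norm y \<Longrightarrow> \<zeta> (x - y) = 0" using test_funD(3)[OF \<psi>] by blast
      have "bounded ((\<lambda>y. V y * \<zeta> (x - y)) ` cball 0 b)" "bounded ((\<lambda>y. w y * \<zeta> (x - y)) ` cball 0 b)"
        by (intro compact_imp_bounded compact_continuous_image continuous_on_subset[OF continuous_on_mult[OF _ test_funD(2)[OF \<psi>]]] V w(1); simp)+
      then obtain B1 B2 where B: "\<forall>y\<in>cball 0 b. \<bar>V y * \<zeta> (x - y)\<bar> \<le> B1" "B1 > 0"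
         "\<forall>y\<in>cball 0 b. \<bar>w y * \<zeta> (x - y)\<bar> \<le> B2" "B2 > 0"
        unfolding bounded_pos by auto
      show ?thesis
      proof (rule that[of "max B1 B2"])
        show "\<bar>V y * \<zeta> (x - y)\<bar> \<le> max B1 B2" for y
          using B(1,2) b(2)[of y] by (cases "norm y \<le> b") (force simp: le_max_iff_disj)+
        show "\<bar>w y * \<zeta> (x - y)\<bar> \<le> max B1 B2" for y
          using B(3,4) b(2)[of y] by (cases "norm y \<le> b") (force simp: le_max_iff_disj)+
        show "\<exists>b. \<forall>y. b < norm y \<longrightarrow> \<zeta> (x - y) = 0" using b(2) by (auto intro: exI[of _ b])
      qed
    qed
    from b obtain b where b: "\<And>y. b < norm y \<Longrightarrow> \<zeta> (x - y) = 0" by blast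
    have I2: "integrable lebesgue (\<lambda>y. u y * (V y * \<zeta> (x - y)))"
      by (rule L1_loc_mult_integrable[OF L1(1) _ M(1), where b=b])
        (use b in \<open>auto intro!: borel_measurable_continuous_onI continuous_on_mult V test_funD(2)[OF \<psi>]\<close>)
    have I3: "integrable lebesgue (\<lambda>y. u y * (w y * \<zeta> (x - y)))"
      by (rule L1_loc_mult_integrable[OF L1(1) _ M(2), where b=b])
        (use b in \<open>auto intro!: borel_measurable_continuous_onI continuous_on_mult w(1) test_funD(2)[OF \<psi>]\<close>)
    have I4: "integrable lebesgue (\<lambda>y. enn2real (?W y) * u y * \<zeta> (x - y))"
      by (rule L1_loc_test_integrable[OF WL1 \<psi>])
    have I5: "integrable lebesgue (\<lambda>y. u y * \<zeta> (x - y))" by (rule conv_integrable[OF L1(1) \<zeta>(1)])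
    have "\<epsilon>\<^sup>2 * ((Q x - \<eta>) * conv u \<zeta> x) = (LINT y|lebesgue. \<epsilon>\<^sup>2 * ((Q x - \<eta>) * (u y * \<zeta> (x - y))))"
      by (simp add: conv_def)
    also have "\<dots> \<le> (LINT y|lebesgue. 1 / \<epsilon> ^ ?M * (u y * (w y * \<zeta> (x - y))) - u y * (V y * \<zeta> (x - y)))"
    proof (rule integral_mono_AE)
      show "AE y in lebesgue. \<epsilon>\<^sup>2 * ((Q x - \<eta>) * (u y * \<zeta> (x - y))) \<le>
        1 / \<epsilon> ^ ?M * (u y * (w y * \<zeta> (x - y))) - u y * (V y * \<zeta> (x - y))"
        using u(2)
      proof eventually_elim
        case (elim y)
        have "(Q x - \<eta>) * (u y * \<zeta> (x - y)) \<le> Q y * (u y * \<zeta> (x - y))"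
        proof (cases "norm (x - y) < r")
          case True
          then show ?thesis using r(2)[OF x True] elim \<zeta>(2) by (intro mult_right_mono) auto
        next
          case False
          then have "\<zeta> (x - y) = 0" using \<zeta>(2)[of "x - y"] \<zeta>(3)[of "x - y"] by linarith
          then show ?thesis by simp
        qed
        then have "\<epsilon>\<^sup>2 * ((Q x - \<eta>) * (u y * \<zeta> (x - y))) \<le> \<epsilon>\<^sup>2 * (Q y * (u y * \<zeta> (x - y)))"
          by (intro mult_left_mono) auto
        also have "\<epsilon>\<^sup>2 * (Q y * (u y * \<zeta> (x - y))) = \<epsilon>\<^sup>2 * Q y * (u y * \<zeta> (x - y))" by simp
        also have "\<epsilon>\<^sup>2 * Q y = w y / \<epsilon> ^ ?M - V y" using e by (simp add: Q_def right_diff_distrib)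
        finally show ?case by (simp add: algebra_simps)
      qed
    qed (intro Bochner_Integration.integrable_diff integrable_mult_right I2 I3 I5)+
    also have "\<dots> = 1 / \<epsilon> ^ ?M * (LINT y|lebesgue. u y * (w y * \<zeta> (x - y))) - (LINT y|lebesgue. u y * (V y * \<zeta> (x - y)))"
      using I2 I3 by (subst Bochner_Integration.integral_diff) auto
    also have "\<dots> \<le> 1 / \<epsilon> ^ ?M * (LINT y|lebesgue. enn2real (?W y) * u y * \<zeta> (x - y)) - (LINT y|lebesgue. u y * (V y * \<zeta> (x - y)))"
    proof (intro diff_right_mono mult_left_mono integral_mono_AE I3 I4)
      show "AE y in lebesgue. u y * (w y * \<zeta> (x - y)) \<le> enn2real (?W y) * u y * \<zeta> (x - y)"
        using u(2) wW
      proof eventually_elim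
        case (elim y)
        then have "w y * (u y * \<zeta> (x - y)) \<le> enn2real (?W y) * (u y * \<zeta> (x - y))"
          using \<zeta>(2) by (intro mult_right_mono) auto
        then show ?case by (simp add: mult_ac)
      qed
    qed (use e in auto)
    also have "1 / \<epsilon> ^ ?M * (LINT y|lebesgue. enn2real (?W y) * u y * \<zeta> (x - y))
       = (LINT y|lebesgue. - \<epsilon>\<^sup>2 * (\<Sum>i\<in>UNIV. ?G y $ i * d\<zeta> i (x - y)) + u y * (V y * \<zeta> (x - y)))"
      using eq[OF \<psi>] unfolding gr by (simp add: mult_ac)
    also have "\<dots> = - \<epsilon>\<^sup>2 * (LINT y|lebesgue. (\<Sum>i\<in>UNIV. ?G y $ i * d\<zeta> i (x - y))) + (LINT y|lebesgue. u y * (V y * \<zeta> (x - y)))"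
      using I1 I2 by (subst Bochner_Integration.integral_add) auto
    also have "(LINT y|lebesgue. (\<Sum>i\<in>UNIV. ?G y $ i * d\<zeta> i (x - y))) = (\<Sum>i\<in>UNIV. conv u (dd\<zeta> i) x)"
      unfolding laplace using I1 by (rule Bochner_Integration.integral_sum)
    finally have "\<epsilon>\<^sup>2 * ((Q x - \<eta>) * conv u \<zeta> x) \<le> \<epsilon>\<^sup>2 * (- (\<Sum>i\<in>UNIV. conv u (dd\<zeta> i) x))" by simp
    then show ?thesis using e by (simp only: mult_le_cancel_left_pos zero_less_power)
  qed
  show ?thesis
    unfolding positive_supersol_def Q_def[symmetric]
  proof (intro exI conjI allI ballI)
    show "conv u \<zeta> x > 0" for x by (rule conv_pos[OF L1(1) u(2) \<zeta> r(1)])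
    show "continuous_on UNIV (conv u \<zeta>)" by (rule continuous_on_conv[OF L1(1) \<zeta>(1)])
    show "continuous_on UNIV (conv u (d\<zeta> i))" for i by (rule continuous_on_conv[OF L1(1) d\<zeta>])
    show "continuous_on UNIV (conv u (dd\<zeta> i))" for i by (rule continuous_on_conv[OF L1(1) dd\<zeta>])
    show "((\<lambda>t. conv u \<zeta> (x + t *\<^sub>R axis i 1)) has_real_derivative conv u (d\<zeta> i) x) (at 0)" for i x
      unfolding d\<zeta>_def by (rule conv_dir_deriv[OF L1(1) \<zeta>(1)])
    show "((\<lambda>t. conv u (d\<zeta> i) (x + t *\<^sub>R axis i 1)) has_real_derivative conv u (dd\<zeta> i) x) (at 0)" for i x
      unfolding dd\<zeta>_def by (rule conv_dir_deriv[OF L1(1) d\<zeta>])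
    show "(w x / \<epsilon> ^ ?M / \<epsilon>\<^sup>2 - V x / \<epsilon>\<^sup>2 - \<eta>) * conv u \<zeta> x \<le> - (\<Sum>i\<in>UNIV. conv u (dd\<zeta> i) x)" if "x \<in> K" for x
      using ineq[OF that] by (simp add: Q_def)
  qed
qed

section \<open>Mass bound on balls and passage to the whole space\<close>

theorem proposition5p3:
  fixes V u :: "real ^ 'n \<Rightarrow> real" and \<epsilon> :: real
  assumes "CARD('n) \<ge> 3"
    and "continuous_on UNIV V" and "\<And>x. 0 \<le> V x"
    and "((\<lambda>R::real. (1 / R ^ (CARD('n) - 2)) * (LINT x:(ball 0 (2 * R) - ball 0 R)|lebesgue. V x))
           \<longlongrightarrow> 0) at_top"
    and "\<epsilon> > 0"
    and "u \<in> H1_loc" and "u \<in> L2_weighted"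
    and "AE x in lebesgue. u x > 0"
    and "weak_solution \<epsilon> V u"
  shows "ennreal (1 / \<epsilon> ^ CARD('n)) * (\<integral>\<^sup>+ x. ennreal (\<bar>u x\<bar>\<^sup>2) \<partial>lebesgue)
         \<le> ennreal (Gamma ((real CARD('n) - 2) / 2) * pi powr (real CARD('n) / 2)
                     * 2 ^ (CARD('n) - 2) * ((real CARD('n) - 2) / 2)\<^sup>2)"
proof -
  let ?N = "CARD('n)"
  let ?M = "?N - 2"
  define A where "A = riesz_const TYPE('n)"
  define s where "s = (real ?N - 2) / 2"
  have A: "A > 0" unfolding A_def by (rule riesz_const_pos[OF assms(1)])
  have um: "u \<in> borel_measurable lebesgue" using assms(6) by (auto simp: H1_loc_def L2_loc_def)
  \<comment> \<open>Dividing the equation by \<epsilon>^2 joins this factor to the coupling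
    \<epsilon>^(-(N-2)); hence the \<epsilon>^N of the bound.\<close>
  have N: "\<epsilon> ^ ?M * \<epsilon>\<^sup>2 = \<epsilon> ^ ?N" 
  proof -
    have "?M + 2 = ?N" using assms(1) by simp
    then show ?thesis by (simp only: power_add[symmetric])
  qed
  have Vb: "V \<in> borel_measurable borel" by (rule borel_measurable_continuous_onI[OF assms(2)])
  have shell: "(LINT x:(ball 0 (2 * R) - ball 0 R)|lebesgue. V x) = shell_int V R" for R
  proof -
    have "(\<lambda>x. indicator (ball 0 (2 * R) - ball 0 R) x * V x) \<in> borel_measurable lborel"
      using Vb by (intro borel_measurable_times borel_measurable_indicator) simp_all
    then show ?thesis
      by (simp add: set_lebesgue_integral_def shell_int_def integral_completion)
  qed
  have lim: "((\<lambda>R. shell_int (\<lambda>x. V x / \<epsilon>\<^sup>2) R / R ^ ?M) \<longlongrightarrow> 0) at_top"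
  proof -
    have "shell_int (\<lambda>x. V x / \<epsilon>\<^sup>2) R / R ^ ?M = (1 / R ^ ?M * shell_int V R) / \<epsilon>\<^sup>2" for R
      by (simp add: shell_int_def)
    then show ?thesis using tendsto_divide[OF assms(4)[unfolded shell] tendsto_const[of "\<epsilon>\<^sup>2"]] assms(5) by simp
  qed
  have I: "integrable lebesgue (\<lambda>y. indicator (ball 0 \<rho>) y * (u y)\<^sup>2)" for \<rho>
  proof -
    have "integrable lebesgue (\<lambda>y. indicator (cball 0 \<rho>) y *\<^sub>R (norm (u y))\<^sup>2)"
      using assms(6) compact_cball unfolding H1_loc_def L2_loc_def set_integrable_def by blast
    then show ?thesis
    proof (rule Bochner_Integration.integrable_bound)
      show "(\<lambda>y. indicator (ball 0 \<rho>) y * (u y)\<^sup>2) \<in> borel_measurable lebesgue"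
        using um by (intro borel_measurable_times borel_measurable_indicator borel_measurable_power) auto
    qed (auto intro!: AE_I2 simp: indicator_def)
  qed
  \<comment> \<open>Finiteness of the total mass is part of the claim, so the Hardy argument is run
    with the mass \<open>m\<close> of a ball, which is finite by local square integrability, and
    with coefficient \<open>m / A / \<epsilon> ^ ?N\<close>.\<close>
  have ball: "(LINT y|lebesgue. indicator (ball 0 \<rho>) y * (u y)\<^sup>2) / \<epsilon> ^ ?N \<le> A * s\<^sup>2" if \<rho>: "\<rho> > 0" for \<rho>
  proof -
    define m where "m = (LINT y|lebesgue. indicator (ball 0 \<rho>) y * (u y)\<^sup>2)"
    have m0: "m \<ge> 0" unfolding m_def by (intro integral_nonneg_AE) auto
    let ?w = "\<lambda>x::real^'n. m / A / (norm x + \<rho>)\<^sup>2"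
    have "m / A / \<epsilon> ^ ?N \<le> s\<^sup>2"
    proof (rule hardy_limit[where V = "\<lambda>x. V x / \<epsilon>\<^sup>2" and \<rho> = \<rho>, OF _ _ _ _ lim])
      show "positive_supersol K (\<lambda>x. m / A / \<epsilon> ^ ?N / (norm x + \<rho>)\<^sup>2 - V x / \<epsilon>\<^sup>2 - \<eta>)"
        if "compact K" "\<eta> > 0" for K \<eta>
      proof -
        have "positive_supersol K (\<lambda>x. ?w x / \<epsilon> ^ ?M / \<epsilon>\<^sup>2 - V x / \<epsilon>\<^sup>2 - \<eta>)"
        proof (rule weak_solution_positive_supersol[OF assms(5,2,6,8,9) _ _ _ that])
          show "continuous_on UNIV ?w" using \<rho> by (intro continuous_intros) (auto simp: add_nonneg_eq_0_iff)
          show "0 \<le> ?w x" for x using m0 A by simp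
          show "ennreal (?w x) \<le> riesz_conv (\<lambda>y. \<bar>u y\<bar>\<^sup>2) x" for x
            unfolding m_def A_def by (rule riesz_conv_lower[OF assms(1) \<rho> um I])
        qed
        moreover have "?w x / \<epsilon> ^ ?M / \<epsilon>\<^sup>2 = m / A / \<epsilon> ^ ?N / (norm x + \<rho>)\<^sup>2" for x
          by (simp flip: N add: field_simps)
        ultimately show ?thesis by (simp only:)
      qed
    qed (use assms m0 A \<rho> in \<open>auto simp: s_def intro!: continuous_intros\<close>)
    from mult_left_mono[OF this, of A] show ?thesis using A by (simp add: m_def)
  qed
  \<comment> \<open>\<open>Suc n\<close> keeps every radius positive, as \<open>ball\<close>
    demands. Its bound is the same for all radii, so monotone convergence finishes the
    proof.\<close>
  have "(\<integral>\<^sup>+ x. ennreal (\<bar>u x\<bar>\<^sup>2) \<partial>lebesgue) = (SUP n. \<integral>\<^sup>+ x. ennreal (indicator (ball 0 (real (Suc n))) x * (u x)\<^sup>2) \<partial>lebesgue)"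
  proof -
    have "(SUP n. ennreal (indicator (ball 0 (real (Suc n))) x * (u x)\<^sup>2)) = ennreal (\<bar>u x\<bar>\<^sup>2)" for x
    proof (rule antisym)
      show "(SUP n. ennreal (indicator (ball 0 (real (Suc n))) x * (u x)\<^sup>2)) \<le> ennreal (\<bar>u x\<bar>\<^sup>2)"
        by (rule SUP_least) (auto simp: indicator_def)
      obtain n :: nat where "norm x < real n" using reals_Archimedean2 by blast
      then show "ennreal (\<bar>u x\<bar>\<^sup>2) \<le> (SUP n. ennreal (indicator (ball 0 (real (Suc n))) x * (u x)\<^sup>2))"
        by (intro SUP_upper2[of n]) auto
    qed
    moreover have "incseq (\<lambda>n x. ennreal (indicator (ball 0 (real (Suc n))) x * (u x)\<^sup>2))"
      by (auto simp: incseq_def le_fun_def indicator_def)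
    ultimately show ?thesis
      using nn_integral_monotone_convergence_SUP[of "\<lambda>n x. ennreal (indicator (ball 0 (real (Suc n))) x * (u x)\<^sup>2)" lebesgue]
        I by (simp add: image_comp)
  qed
  also have "ennreal (1 / \<epsilon> ^ ?N) * \<dots> \<le> ennreal (A * s\<^sup>2)"
    unfolding SUP_mult_left_ennreal
  proof (rule SUP_least)
    fix n
    let ?m = "LINT y|lebesgue. indicator (ball 0 (real (Suc n))) y * (u y)\<^sup>2"
    have "(\<integral>\<^sup>+ x. ennreal (indicator (ball 0 (real (Suc n))) x * (u x)\<^sup>2) \<partial>lebesgue) = ennreal ?m"
      by (intro nn_integral_eq_integral I AE_I2) auto
    then have "ennreal (1 / \<epsilon> ^ ?N) * (\<integral>\<^sup>+ x. ennreal (indicator (ball 0 (real (Suc n))) x * (u x)\<^sup>2) \<partial>lebesgue)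
      = ennreal (1 / \<epsilon> ^ ?N * ?m)"
      using assms(5) by (subst ennreal_mult) (auto intro!: integral_nonneg_AE)
    also have "\<dots> \<le> ennreal (A * s\<^sup>2)" using ball[of "real (Suc n)"] by (intro ennreal_leI) simp
    finally show "ennreal (1 / \<epsilon> ^ ?N) * (\<integral>\<^sup>+ x. ennreal (indicator (ball 0 (real (Suc n))) x * (u x)\<^sup>2) \<partial>lebesgue)
      \<le> ennreal (A * s\<^sup>2)" .
  qed
  finally show ?thesis by (simp add: A_def s_def riesz_const_def)
qed

end
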